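(* Let $\mu\in P_2(\mathbb{R}^d)$ and $\nu\in P_2(\mathbb{R}^d)$ absolutely continuous with respect to Lebesgue measure. Let $\varphi\in\mathcal{A}_{cx}\cap C_{b,2}$ be an optimizer of $$\mathcal{D}_2(\mathrm{P}^{cx}_{2,\mu\le},\nu)=\sup_{g\in\mathcal{A}_{cx}\cap\mathrm{S}_{b,2}}\Big\{\int g\,d\mu-\int Q_{\bar2}(g)\,d\nu\Big\},$$ and put $\bar\varphi_0(x)=\frac12|x|^2-\frac12\varphi(x)$. Then (i) $\bar\varphi_0^*$ is a convex expansion and is uniformly convex; (ii) $(\nabla\bar\varphi_0^* )_\#\nu$ is the unique minimizer of $\mathcal{T}_2(\cdot,\nu)$ over $\mathrm{P}^{cx}_{2,\mu\le}$.
   Context: $\mu\le_{cx}\xi$: $\int\varphi\,d\mu\le\int\varphi\,d\xi$ for all real-valued convex $\varphi$ with both integrals existing in the extended sense. $\mathcal{A}_{cx}$: proper lsc convex functions on $\mathbb{R}^d$. $\mathrm{P}^{cx}_{2,\mu\le}=\{\xi\in P_2(\mathbb{R}^d):\mu\le_{cx}\xi\}$. $C_{b,2}$ (resp. $\mathrm{S}_{b,2}$): continuous (resp. measurable) $u$ with $\sup|u(x)|/(1+|x|^2)<\infty$. $Q_{\bar2}(g)(y)=\sup_x\{g(x)-|x-y|^2\}$. $\mathcal{T}_2(\xi,\nu)=\inf_{\pi\in\Pi(\xi,\nu)}\int|x-y|^2d\pi$. $g^*(y)=\sup_x\{x\cdot y-g(x)\}$ is the Legendre transform. A proper lsc convex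 $\psi$ is a convex expansion if $\psi=\phi^*$ for some proper $\phi$ with $D^2\phi\le \mathrm{Id}$ in the sense of distributions (equivalently $D^2\psi\ge\mathrm{Id}$). *)

theory Defs
  imports "HOL-Probability.Probability"
begin

definition P2 :: "'a::euclidean_space measure set" where
  "P2 = {\<mu>. prob_space \<mu> \<and> sets \<mu> = sets borel \<and>
              (\<integral>\<^sup>+ x. ennreal (norm x ^ 2) \<partial>\<mu>) < \<infinity>}"

definition eint_pos :: "'a measure \<Rightarrow> ('a \<Rightarrow> ereal) \<Rightarrow> ennreal" where
  "eint_pos M f = (\<integral>\<^sup>+ x. e2ennreal (f x) \<partial>M)"

definition eint_neg :: "'a measure \<Rightarrow> ('a \<Rightarrow> ereal) \<Rightarrow> ennreal" where
  "eint_neg M f = (\<integral>\<^sup>+ x. e2ennreal (- f x) \<partial>M)"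

definition eint_exists :: "'a measure \<Rightarrow> ('a \<Rightarrow> ereal) \<Rightarrow> bool" where
  "eint_exists M f \<longleftrightarrow> f \<in> borel_measurable M \<and>
     \<not> (eint_pos M f = \<infinity> \<and> eint_neg M f = \<infinity>)"

definition eint :: "'a measure \<Rightarrow> ('a \<Rightarrow> ereal) \<Rightarrow> ereal" where
  "eint M f = enn2ereal (eint_pos M f) - enn2ereal (eint_neg M f)"

definition cx_le :: "'a::euclidean_space measure \<Rightarrow> 'a measure \<Rightarrow> bool" where
  "cx_le \<mu> \<xi> \<longleftrightarrow> (\<forall>\<phi>::'a \<Rightarrow> real. convex_on UNIV \<phi> \<longrightarrow>
      eint_exists \<mu> (\<lambda>x. ereal (\<phi> x)) \<longrightarrow> eint_exists \<xi> (\<lambda>x. ereal (\<phi> x)) \<longrightarrow>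
      eint \<mu> (\<lambda>x. ereal (\<phi> x)) \<le> eint \<xi> (\<lambda>x. ereal (\<phi> x)))"

definition P2cx_above :: "'a::euclidean_space measure \<Rightarrow> 'a measure set" where
  "P2cx_above \<mu> = {\<xi> \<in> P2. cx_le \<mu> \<xi>}"

definition ereal_convex :: "('a::real_vector \<Rightarrow> ereal) \<Rightarrow> bool" where
  "ereal_convex f \<longleftrightarrow> (\<forall>x y t. 0 < t \<and> t < 1 \<longrightarrow>
      f (t *\<^sub>R x + (1 - t) *\<^sub>R y) \<le> ereal t * f x + ereal (1 - t) * f y)"

definition proper_fun :: "('a \<Rightarrow> ereal) \<Rightarrow> bool" where
  "proper_fun f \<longleftrightarrow> (\<forall>x. f x \<noteq> -\<infinity>) \<and> (\<exists>x. f x \<noteq> \<infinity>)"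

definition lsc :: "('a::topological_space \<Rightarrow> ereal) \<Rightarrow> bool" where
  "lsc f \<longleftrightarrow> (\<forall>x. f x \<le> Liminf (at x) f)"

definition A_cx :: "('a::euclidean_space \<Rightarrow> ereal) set" where
  "A_cx = {f. proper_fun f \<and> lsc f \<and> ereal_convex f}"

definition S_b2 :: "('a::euclidean_space \<Rightarrow> real) set" where
  "S_b2 = {u. u \<in> borel_measurable borel \<and> (\<exists>C. \<forall>x. \<bar>u x\<bar> \<le> C * (1 + norm x ^ 2))}"

definition C_b2 :: "('a::euclidean_space \<Rightarrow> real) set" where
  "C_b2 = {u. continuous_on UNIV u \<and> (\<exists>C. \<forall>x. \<bar>u x\<bar> \<le> C * (1 + norm x ^ 2))}"

definition Qbar2 :: "('a::euclidean_space \<Rightarrow> real) \<Rightarrow> 'a \<Rightarrow> ereal" where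
  "Qbar2 g y = (SUP x. ereal (g x - norm (x - y) ^ 2))"

definition legendre :: "('a::euclidean_space \<Rightarrow> ereal) \<Rightarrow> 'a \<Rightarrow> ereal" where
  "legendre g y = (SUP x. ereal (x \<bullet> y) - g x)"

definition dual_obj :: "'a::euclidean_space measure \<Rightarrow> 'a measure \<Rightarrow> ('a \<Rightarrow> real) \<Rightarrow> ereal" where
  "dual_obj \<mu> \<nu> g = ereal (\<integral>x. g x \<partial>\<mu>) - eint \<nu> (Qbar2 g)"

definition D2 :: "'a::euclidean_space measure \<Rightarrow> 'a measure \<Rightarrow> ereal" where
  "D2 \<mu> \<nu> = (SUP g\<in>{g. (\<lambda>x. ereal (g x)) \<in> A_cx \<and> g \<in> S_b2}. dual_obj \<mu> \<nu> g)"

definition convex_expansion :: "('a::euclidean_space \<Rightarrow> ereal) \<Rightarrow> bool" where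
  "convex_expansion \<psi> \<longleftrightarrow> \<psi> \<in> A_cx \<and>
     (\<exists>\<phi>::'a \<Rightarrow> real. convex_on UNIV (\<lambda>x. norm x ^ 2 / 2 - \<phi> x) \<and>
        \<psi> = legendre (\<lambda>x. ereal (\<phi> x)))"

definition uniformly_convex :: "('a::real_normed_vector \<Rightarrow> ereal) \<Rightarrow> bool" where
  "uniformly_convex f \<longleftrightarrow> (\<exists>\<omega>::real \<Rightarrow> ereal. mono_on {0..} \<omega> \<and>
      (\<forall>t\<ge>0. \<omega> t \<ge> 0 \<and> (\<omega> t = 0 \<longleftrightarrow> t = 0)) \<and>
      (\<forall>x y t. f x < \<infinity> \<and> f y < \<infinity> \<and> 0 < t \<and> t < 1 \<longrightarrow>
         f (t *\<^sub>R x + (1 - t) *\<^sub>R y) + ereal (t * (1 - t)) * \<omega> (norm (x - y))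
           \<le> ereal t * f x + ereal (1 - t) * f y))"

definition diff_at :: "('a::euclidean_space \<Rightarrow> ereal) \<Rightarrow> 'a \<Rightarrow> 'a \<Rightarrow> bool" where
  "diff_at \<psi> y v \<longleftrightarrow> (\<forall>\<^sub>F z in nhds y. \<bar>\<psi> z\<bar> \<noteq> \<infinity>) \<and>
     ((\<lambda>z. real_of_ereal (\<psi> z)) has_derivative (\<lambda>h. v \<bullet> h)) (at y)"

definition grad :: "('a::euclidean_space \<Rightarrow> ereal) \<Rightarrow> 'a \<Rightarrow> 'a" where
  "grad \<psi> y = (if \<exists>v. diff_at \<psi> y v then SOME v. diff_at \<psi> y v else 0)"

definition couplings :: "'a::euclidean_space measure \<Rightarrow> 'a measure \<Rightarrow> ('a \<times> 'a) measure set" where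
  "couplings \<xi> \<nu> = {\<pi>. sets \<pi> = sets (borel \<Otimes>\<^sub>M borel) \<and>
      distr \<pi> borel fst = \<xi> \<and> distr \<pi> borel snd = \<nu>}"

definition T2 :: "'a::euclidean_space measure \<Rightarrow> 'a measure \<Rightarrow> ennreal" where
  "T2 \<xi> \<nu> = (INF \<pi>\<in>couplings \<xi> \<nu>. \<integral>\<^sup>+ p. ennreal (norm (fst p - snd p) ^ 2) \<partial>\<pi>)"

end

theory Submission
  imports Defs
begin

text \<open>Write \<open>\<psi>\<close> for the Legendre transform of \<open>phi0\<close>. Completing the square gives
  \<open>Qbar2 \<phi> y = 2 * \<psi> y - (norm y)\<^sup>2\<close>, so that
  \<open>(norm (x - y))\<^sup>2 = \<phi> x - Qbar2 \<phi> y + 2 * gap x y\<close>, where the Young gap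
  \<open>gap x y = phi0 x + \<psi> y - x \<bullet> y\<close> is nonnegative and, at almost every \<open>y\<close>, vanishes only for
  \<open>x = grad \<psi> y\<close>. Integrating against a coupling yields weak duality.

  Optimality enters through the variations \<open>(1 - \<epsilon>) * \<phi> + \<epsilon> * h\<close>: these stay admissible because
  \<open>Qbar2\<close> is convex in its argument, whereas \<open>Qbar2 (\<phi> + \<epsilon> * h)\<close> may be infinite. Maximizers for the
  perturbed problem converge to \<open>grad \<psi> y\<close>, so Fatou's lemma gives
  \<open>\<integral>h - \<phi> d\<mu> \<le> \<integral>h - \<phi> d\<xi>0\<close>. Taking \<open>h = 0\<close> yields square integrability of \<open>grad \<psi>\<close> and
  \<open>\<integral>\<phi> d\<xi>0 \<le> \<integral>\<phi> d\<mu>\<close>; taking \<open>h\<close> to be large multiples of a Lipschitz convex function yields the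
  convex order. Hence there is no duality gap, and near-optimal couplings of any minimizer
  concentrate on the graph of \<open>grad \<psi>\<close>, which proves uniqueness.\<close>

section \<open>Suprema of continuous functions and sets of convergence\<close>

text \<open>Strict superlevel sets are unions of open sets, so the index set may be uncountable, as
  it is for the suprema defining \<open>legendre\<close> and \<open>Qbar2\<close>.\<close>

lemma borel_measurable_SUP_continuous:
  fixes F :: "'b \<Rightarrow> 'a::topological_space \<Rightarrow> real"
  assumes "\<And>x. x \<in> I \<Longrightarrow> continuous_on UNIV (F x)"
  shows "(\<lambda>y. SUP x\<in>I. ereal (F x y)) \<in> borel_measurable borel"
proof -
  have "open {y. a < (SUP x\<in>I. ereal (F x y))}" for a
  proof -
    have "{y. a < (SUP x\<in>I. ereal (F x y))} = (\<Union>x\<in>I. {y. a < ereal (F x y)})"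
      by (auto simp: less_SUP_iff)
    moreover have "open {y. a < ereal (F x y)}" if "x \<in> I" for x
      by (intro open_Collect_less continuous_intros continuous_on_ereal assms that)
    ultimately show ?thesis by auto
  qed
  then show ?thesis
    by (auto simp: borel_measurable_ereal_iff_Ioi vimage_def)
qed

lemma lsc_SUP_continuous:
  fixes F :: "'b \<Rightarrow> 'a::perfect_space \<Rightarrow> real"
  assumes "\<And>x. x \<in> I \<Longrightarrow> continuous_on UNIV (F x)"
  shows "lsc (\<lambda>y. SUP x\<in>I. ereal (F x y))"
  unfolding lsc_def
proof (intro allI SUP_least)
  fix y x assume x: "x \<in> I"
  have "((\<lambda>z. ereal (F x z)) \<longlongrightarrow> ereal (F x y)) (at y)"
    using assms[OF x] by (auto simp: continuous_on_def)
  then have "Liminf (at y) (\<lambda>z. ereal (F x z)) = ereal (F x y)"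
    by (intro lim_imp_Liminf) auto
  moreover have "Liminf (at y) (\<lambda>z. ereal (F x z)) \<le> Liminf (at y) (\<lambda>y. SUP x\<in>I. ereal (F x y))"
    by (intro Liminf_mono always_eventually allI SUP_upper x)
  ultimately show "ereal (F x y) \<le> Liminf (at y) (\<lambda>y. SUP x\<in>I. ereal (F x y))"
    by simp
qed

lemma sets_tendsto_zero:
  fixes u :: "nat \<Rightarrow> 'a \<Rightarrow> real"
  assumes [measurable]: "\<And>n. u n \<in> borel_measurable M"
  shows "{y \<in> space M. (\<lambda>n. u n y) \<longlonglongrightarrow> 0} \<in> sets M"
proof -
  \<comment> \<open>Testing only against \<open>1 / (k + 1)\<close> leaves countable quantifiers,
    hence countable unions and intersections of measurable sets.\<close>
  have *: "(\<lambda>n. u n) \<longlonglongrightarrow> (0::real) \<longleftrightarrow> (\<forall>k. \<exists>N. \<forall>n\<ge>N. \<bar>u n\<bar> < inverse (real (Suc k)))" for u :: "nat \<Rightarrow> real"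
  proof
    assume "u \<longlonglongrightarrow> 0"
    then show "\<forall>k. \<exists>N. \<forall>n\<ge>N. \<bar>u n\<bar> < inverse (real (Suc k))"
      using LIMSEQ_D[of u 0] by (auto simp del: of_nat_Suc)
  next
    assume R: "\<forall>k. \<exists>N. \<forall>n\<ge>N. \<bar>u n\<bar> < inverse (real (Suc k))"
    show "u \<longlonglongrightarrow> 0"
    proof (rule LIMSEQ_I)
      fix e :: real assume "e > 0"
      then obtain k where "inverse (real (Suc k)) < e" using reals_Archimedean by blast
      with R show "\<exists>no. \<forall>n\<ge>no. norm (u n - 0) < e" by (metis diff_zero less_trans real_norm_def)
    qed
  qed
  show ?thesis unfolding * by measurable
qed

section \<open>Legendre transforms of continuous functions\<close>

text \<open>Continuity of \<open>g\<close> makes suprema over compact balls attained; convexity of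
  the transform comes from its being a supremum of affine functions.\<close>

locale conjugate =
  fixes g :: "'a::euclidean_space \<Rightarrow> real"
  assumes cont: "continuous_on UNIV g"
begin

definition "Psi = legendre (\<lambda>x. ereal (g x))"
definition "S = {y. Psi y < \<infinity>}"
text \<open>Off the effective domain \<open>S\<close> the value is the default 0 of
  \<open>real_of_ereal \<infinity>\<close>, so facts about \<open>f\<close> carry membership in
  \<open>S\<close>.\<close>

definition "f y = real_of_ereal (Psi y)"
text \<open>Equality in Young's inequality; by \<open>subgradient\<close> such a \<open>v\<close> is
  a subgradient of the transform at \<open>y\<close>.\<close>

definition "maximizer v y \<longleftrightarrow> y \<in> S \<and> f y = v \<bullet> y - g v"

lemma Psi_eq: "Psi = (\<lambda>y. SUP x. ereal (x \<bullet> y - g x))"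
  by (auto simp: Psi_def legendre_def)

lemma Psi_ge: "ereal (x \<bullet> y - g x) \<le> Psi y"
  unfolding Psi_eq by (rule SUP_upper) auto

lemma Psi_not_MInf: "Psi y \<noteq> -\<infinity>"
  using Psi_ge[of 0 y] by auto

lemma Psi_eq_f: "y \<in> S \<Longrightarrow> Psi y = ereal (f y)"
  using Psi_not_MInf[of y] unfolding S_def f_def by (cases "Psi y") auto

lemma in_S_iff: "y \<in> S \<longleftrightarrow> \<bar>Psi y\<bar> \<noteq> \<infinity>"
  using Psi_not_MInf[of y] unfolding S_def by (cases "Psi y") auto

lemma young: "y \<in> S \<Longrightarrow> x \<bullet> y - g x \<le> f y"
  using Psi_ge[of x y] by (simp add: Psi_eq_f)

lemma Psi_le: "(\<And>x. x \<bullet> y - g x \<le> c) \<Longrightarrow> Psi y \<le> ereal c"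
  unfolding Psi_eq by (rule SUP_least) auto

lemma f_approx: "y \<in> S \<Longrightarrow> e > 0 \<Longrightarrow> \<exists>x. f y - e < x \<bullet> y - g x"
  using Psi_le[of y "f y - e"] Psi_eq_f[of y] by (force simp: not_less)

lemma subgradient: "maximizer v y \<Longrightarrow> z \<in> S \<Longrightarrow> f y + v \<bullet> (z - y) \<le> f z"
  using young[of z v] by (auto simp: maximizer_def inner_diff_right)

lemma Psi_borel [measurable]: "Psi \<in> borel_measurable borel"
  unfolding Psi_eq by (intro borel_measurable_SUP_continuous continuous_intros)

lemma f_borel [measurable]: "f \<in> borel_measurable borel"
  unfolding f_def[abs_def] by measurable

lemma S_borel [measurable]: "S \<in> sets borel"
  unfolding S_def by measurable

lemma convex_combination_le:
  assumes "y \<in> S" "z \<in> S" "0 \<le> t" "t \<le> 1"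
  shows "Psi (t *\<^sub>R y + (1 - t) *\<^sub>R z) \<le> ereal (t * f y + (1 - t) * f z)"
proof (rule Psi_le)
  fix x
  have "t * (x \<bullet> y - g x) + (1 - t) * (x \<bullet> z - g x) \<le> t * f y + (1 - t) * f z"
    using assms by (intro add_mono mult_left_mono young) auto
  then show "x \<bullet> (t *\<^sub>R y + (1 - t) *\<^sub>R z) - g x \<le> t * f y + (1 - t) * f z"
    by (simp add: inner_add_right algebra_simps)
qed

lemma convex_S: "convex S"
  unfolding convex_alt
proof (intro ballI allI impI)
  fix y z and u :: real assume "y \<in> S" "z \<in> S" "0 \<le> u \<and> u \<le> 1"
  then have "Psi ((1 - u) *\<^sub>R y + (1 - (1 - u)) *\<^sub>R z) \<le> ereal ((1 - u) * f y + (1 - (1 - u)) * f z)"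
    by (intro convex_combination_le) auto
  then show "(1 - u) *\<^sub>R y + u *\<^sub>R z \<in> S"
    unfolding S_def by (auto simp: le_less_trans)
qed

text \<open>Finiteness of \<open>f\<close> at the points \<open>y + r *\<^sub>R b\<close> and
  \<open>y - r *\<^sub>R b\<close> confines all near-maximizers to a ball, where a continuous
  function attains its supremum.\<close>

lemma maximizer_exists:
  assumes "y \<in> interior S"
  obtains v where "maximizer v y"
proof -
  obtain r where r: "r > 0" "cball y r \<subseteq> S"
    using assms by (auto simp: mem_interior_cball)
  have yS: "y \<in> S" and bS: "b \<in> Basis \<Longrightarrow> y + r *\<^sub>R b \<in> S" "b \<in> Basis \<Longrightarrow> y - r *\<^sub>R b \<in> S" for b
    using r by (auto simp: subset_iff dist_norm)
  \<comment> \<open>Each summand bounds one coordinate of a point within 1 of the supremum; the sum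
    bounds the 1-norm and hence the norm.\<close>
  define M where "M = (\<Sum>b\<in>Basis. (\<bar>f (y + r *\<^sub>R b)\<bar> + \<bar>f (y - r *\<^sub>R b)\<bar> + \<bar>f y\<bar> + 1) / r)"
  have bound: "norm x \<le> M" if x: "f y - 1 < x \<bullet> y - g x" for x
  proof -
    have "\<bar>x \<bullet> b\<bar> \<le> (\<bar>f (y + r *\<^sub>R b)\<bar> + \<bar>f (y - r *\<^sub>R b)\<bar> + \<bar>f y\<bar> + 1) / r" if b: "b \<in> Basis" for b
    proof -
      have "r * (x \<bullet> b) \<le> f (y + r *\<^sub>R b) - f y + 1" "- (r * (x \<bullet> b)) \<le> f (y - r *\<^sub>R b) - f y + 1"
        using young[OF bS(1)[OF b], of x] young[OF bS(2)[OF b], of x] x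
        by (auto simp: inner_add_right inner_diff_right)
      then have "\<bar>r * (x \<bullet> b)\<bar> \<le> \<bar>f (y + r *\<^sub>R b)\<bar> + \<bar>f (y - r *\<^sub>R b)\<bar> + \<bar>f y\<bar> + 1"
        by linarith
      then show ?thesis
        using r(1) by (simp add: abs_mult field_simps)
    qed
    then have "(\<Sum>b\<in>Basis. \<bar>x \<bullet> b\<bar>) \<le> M"
      unfolding M_def by (rule sum_mono)
    with norm_le_l1[of x] show ?thesis by linarith
  qed
  obtain x0 where x0: "f y - 1 < x0 \<bullet> y - g x0"
    using f_approx[OF yS, of 1] by auto
  have "continuous_on (cball 0 M) (\<lambda>x. x \<bullet> y - g x)"
    by (intro continuous_intros continuous_on_subset[OF cont]) auto
  moreover have "cball 0 M \<noteq> ({} :: 'a set)"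
    using bound[OF x0] mem_cball_0 by blast
  ultimately have "\<exists>v\<in>cball 0 M. \<forall>x\<in>cball 0 M. x \<bullet> y - g x \<le> v \<bullet> y - g v"
    by (intro continuous_attains_sup compact_cball)
  then obtain v where v: "\<And>x. norm x \<le> M \<Longrightarrow> x \<bullet> y - g x \<le> v \<bullet> y - g v"
    unfolding Bex_def Ball_def mem_cball_0 by blast
  \<comment> \<open>Points outside the ball have value at most \<open>f y - 1\<close>, below the
    value at \<open>x0\<close>, so the maximum over the ball is global.\<close>
  have "x \<bullet> y - g x \<le> v \<bullet> y - g v" for x
  proof (cases "f y - 1 < x \<bullet> y - g x")
    case True then show ?thesis using bound v by auto
  next
    case False then show ?thesis using x0 v[OF bound[OF x0]] by auto
  qed
  then have "Psi y \<le> ereal (v \<bullet> y - g v)" by (rule Psi_le)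
  then have "maximizer v y"
    using yS young[OF yS, of v] Psi_eq_f[OF yS] by (auto simp: maximizer_def)
  then show ?thesis using that by blast
qed

section \<open>Differentiability of the transform via second differences\<close>

text \<open>The step is \<open>1 / n\<close> but the factor is \<open>n\<close>, not its square: for
  convex \<open>f\<close> at an interior point the limit is the jump between the one-sided
  derivatives along \<open>b\<close>, which vanishes exactly where these agree.\<close>

definition second_diff :: "'a \<Rightarrow> nat \<Rightarrow> 'a \<Rightarrow> real" where
  "second_diff b n y = real n * (f (y + b /\<^sub>R real n) + f (y - b /\<^sub>R real n) - 2 * f y)"

lemma second_diff_borel [measurable]: "second_diff b n \<in> borel_measurable borel"
  unfolding second_diff_def[abs_def] by measurable

text \<open>For convex functions differentiability along a basis already gives total
  differentiability (see \<open>diff_at_iff\<close>); this criterion uses countably many values of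
  \<open>f\<close> and is therefore Borel.\<close>

definition "smooth = {y \<in> interior S. \<forall>b\<in>Basis. (\<lambda>n. second_diff b n y) \<longlonglongrightarrow> 0}"

lemma interior_shift:
  assumes "y \<in> interior S" "norm b = 1"
  obtains N where "N > 0" "\<And>n. n \<ge> N \<Longrightarrow> y + b /\<^sub>R real n \<in> interior S \<and> y - b /\<^sub>R real n \<in> interior S"
proof -
  obtain r where r: "r > 0" "ball y r \<subseteq> interior S"
    using assms open_interior by (metis openE)
  obtain N where N: "inverse (real (Suc N)) < r" using reals_Archimedean[OF r(1)] by blast
  have "y + b /\<^sub>R real n \<in> interior S \<and> y - b /\<^sub>R real n \<in> interior S" if "n \<ge> Suc N" for n
  proof -
    have "inverse (real n) \<le> inverse (real (Suc N))"
      using that by (intro le_imp_inverse_le) auto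
    then have "y + b /\<^sub>R real n \<in> ball y r" "y - b /\<^sub>R real n \<in> ball y r"
      using N assms(2) by (auto simp: dist_norm)
    then show ?thesis using r by auto
  qed
  then show ?thesis using that[of "Suc N"] by auto
qed

text \<open>Young's inequality for \<open>x\<close> is compared with the subgradient inequality for
  \<open>v\<close> at the two shifted points. Increasing \<open>n\<close> shrinks the second
  difference at a smooth point, at the price of multiplying the deficit of \<open>x\<close> by
  \<open>n\<close>.\<close>

lemma gap_estimate:
  assumes v: "maximizer v y" and S: "y + b /\<^sub>R real n \<in> S" "y - b /\<^sub>R real n \<in> S" and n: "n > 0"
  shows "\<bar>(x - v) \<bullet> b\<bar> \<le> real n * (f y - (x \<bullet> y - g x)) + second_diff b n y"
proof -
  let ?c = "b /\<^sub>R real n"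
  have "f y + v \<bullet> ?c \<le> f (y + ?c)" "f y - v \<bullet> ?c \<le> f (y - ?c)"
    using subgradient[OF v S(1)] subgradient[OF v S(2)] by (auto simp: inner_diff_right)
  moreover have "x \<bullet> y + x \<bullet> ?c - g x \<le> f (y + ?c)" "x \<bullet> y - x \<bullet> ?c - g x \<le> f (y - ?c)"
    using young[OF S(1), of x] young[OF S(2), of x] by (auto simp: inner_add_right inner_diff_right)
  ultimately have "\<bar>x \<bullet> ?c - v \<bullet> ?c\<bar> \<le> (f y - (x \<bullet> y - g x)) + (f (y + ?c) + f (y - ?c) - 2 * f y)"
    by linarith
  then have "real n * \<bar>x \<bullet> ?c - v \<bullet> ?c\<bar> \<le> real n * (f y - (x \<bullet> y - g x)) + second_diff b n y"
    unfolding second_diff_def by (metis distrib_left mult_left_mono of_nat_0_le_iff)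
  moreover have "real n * \<bar>x \<bullet> ?c - v \<bullet> ?c\<bar> = \<bar>(x - v) \<bullet> b\<bar>"
  proof -
    have "x \<bullet> ?c - v \<bullet> ?c = ((x - v) \<bullet> b) / real n"
      by (simp add: inner_diff_left divide_inverse algebra_simps)
    then show ?thesis using n by (simp only: abs_divide) simp
  qed
  ultimately show ?thesis by simp
qed

text \<open>\<open>gap_estimate\<close> in every basis direction forces near-maximizers towards the
  maximizer, which is thereby unique.\<close>

lemma smooth_tendsto:
  assumes y: "y \<in> smooth" and v: "maximizer v y"
    and x: "(\<lambda>n. f y - (x n \<bullet> y - g (x n))) \<longlonglongrightarrow> 0"
  shows "x \<longlonglongrightarrow> v"
proof -
  have "(\<lambda>n. (x n - v) \<bullet> b) \<longlonglongrightarrow> 0" if b: "b \<in> Basis" for b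
  proof (rule LIMSEQ_I)
    fix e :: real assume e: "e > 0"
    have yI: "y \<in> interior S" using y by (auto simp: smooth_def)
    obtain N where N: "N > 0" "\<And>n. n \<ge> N \<Longrightarrow> y + b /\<^sub>R real n \<in> interior S \<and> y - b /\<^sub>R real n \<in> interior S"
      using interior_shift[OF yI norm_Basis[OF b]] by blast
    have "(\<lambda>n. second_diff b n y) \<longlonglongrightarrow> 0" using y b by (auto simp: smooth_def)
    then obtain N' where N': "\<And>n. n \<ge> N' \<Longrightarrow> \<bar>second_diff b n y\<bar> < e / 2"
      using LIMSEQ_D[of "\<lambda>n. second_diff b n y" 0 "e / 2"] e by auto
    \<comment> \<open>The scale \<open>m\<close> is frozen first, so that the deficit can afterwards
      be made small relative to it.\<close>
    define m where "m = max N N'"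
    have m: "m > 0" "y + b /\<^sub>R real m \<in> S" "y - b /\<^sub>R real m \<in> S" "second_diff b m y < e / 2"
      using N(1) N(2)[of m] N'[of m] interior_subset unfolding m_def by (auto simp: subset_iff abs_less_iff)
    obtain K where K: "\<And>n. n \<ge> K \<Longrightarrow> \<bar>f y - (x n \<bullet> y - g (x n))\<bar> < e / 2 / m"
      using LIMSEQ_D[OF x, of "e / 2 / m"] e m(1) by auto
    show "\<exists>no. \<forall>n\<ge>no. norm ((x n - v) \<bullet> b - 0) < e"
    proof (intro exI allI impI)
      fix n assume n: "n \<ge> K"
      have "\<bar>(x n - v) \<bullet> b\<bar> \<le> real m * (f y - (x n \<bullet> y - g (x n))) + second_diff b m y"
        by (rule gap_estimate) (use v m in auto)
      moreover have "real m * (f y - (x n \<bullet> y - g (x n))) < real m * (e / 2 / m)"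
        using K[OF n] m(1) by (intro mult_strict_left_mono) auto
      ultimately show "norm ((x n - v) \<bullet> b - 0) < e" using m by auto
    qed
  qed
  then have "(\<lambda>n. x n - v) \<longlonglongrightarrow> 0"
    by (subst tendsto_componentwise_iff) auto
  then show ?thesis by (simp add: LIM_zero_iff)
qed

text \<open>The remainder at \<open>z\<close> lies between 0 and
  \<open>norm (w - v) * norm (z - y)\<close> for a maximizer \<open>w\<close> at \<open>z\<close>.
  Since \<open>w\<close> is also nearly maximal at \<open>y\<close>, \<open>gap_estimate\<close>
  shows that \<open>w\<close> is close to \<open>v\<close>.\<close>

lemma smooth_has_derivative:
  assumes y: "y \<in> smooth" and v: "maximizer v y"
  shows "(f has_derivative (\<lambda>h. v \<bullet> h)) (at y)"
  unfolding has_derivative_at_alt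
proof (intro conjI allI impI)
  show "bounded_linear ((\<bullet>) v)" by (rule bounded_linear_inner_right)
next
  fix e :: real assume e: "e > 0"
  let ?d = "real DIM('a)"
  have yI: "y \<in> interior S" using y by (auto simp: smooth_def)
  then obtain r where r: "r > 0" "ball y r \<subseteq> interior S"
    using open_interior by (metis openE)
  have "(\<lambda>n. 2 * (\<Sum>b\<in>Basis. second_diff b n y)) \<longlonglongrightarrow> 2 * (\<Sum>b\<in>(Basis::'a set). 0)"
    using y by (intro tendsto_intros) (auto simp: smooth_def)
  then obtain N where N: "\<And>n. n \<ge> N \<Longrightarrow> 2 * (\<Sum>b\<in>Basis. second_diff b n y) < e"
    using e LIMSEQ_D[of "\<lambda>n. 2 * (\<Sum>b\<in>Basis. second_diff b n y)" 0 e] by (auto simp: abs_less_iff)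
  obtain n0 where n0: "inverse (real (Suc n0)) < r" using reals_Archimedean[OF r(1)] by blast
  define n where "n = max N (Suc n0)"
  have n: "n > 0" "2 * (\<Sum>b\<in>Basis. second_diff b n y) < e" using N[of n] by (auto simp: n_def)
  have "inverse (real n) \<le> inverse (real (Suc n0))"
    unfolding n_def by (intro le_imp_inverse_le) auto
  then have nS: "y + b /\<^sub>R real n \<in> S" "y - b /\<^sub>R real n \<in> S" if "b \<in> Basis" for b
    using n0 that r(2) interior_subset[of S] by (auto simp: subset_iff dist_norm)
  \<comment> \<open>The second entry makes \<open>real n * ?d * norm (z - y)\<close> at most 1/2, so
    that \<open>norm (w - v)\<close> can be absorbed into the left side below.\<close>
  define \<delta> where "\<delta> = min r (inverse (2 * real n * ?d))"
  have "\<delta> > 0" using r n by (auto simp: \<delta>_def)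
  moreover have "norm (f z - f y - v \<bullet> (z - y)) \<le> e * norm (z - y)" if z: "norm (z - y) < \<delta>" for z
  proof -
    have zI: "z \<in> interior S" using z r by (auto simp: \<delta>_def dist_norm norm_minus_commute subset_iff)
    then obtain w where w: "maximizer w z" by (rule maximizer_exists)
    have S: "y \<in> S" "z \<in> S" using yI zI interior_subset by auto
    have lo: "f y + v \<bullet> (z - y) \<le> f z" by (rule subgradient[OF v S(2)])
    have up: "f z - f y - v \<bullet> (z - y) \<le> norm (w - v) * norm (z - y)"
    proof -
      have "f z + w \<bullet> (y - z) \<le> f y" by (rule subgradient[OF w S(1)])
      then have "f z - f y - v \<bullet> (z - y) \<le> (w - v) \<bullet> (z - y)"
        by (simp add: inner_diff_left inner_diff_right)
      also have "\<dots> \<le> norm (w - v) * norm (z - y)" by (rule norm_cauchy_schwarz)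
      finally show ?thesis .
    qed
    have gap: "f y - (w \<bullet> y - g w) \<le> norm (w - v) * norm (z - y)"
    proof -
      have "f z = w \<bullet> z - g w" using w by (simp add: maximizer_def)
      then have "f y - (w \<bullet> y - g w) = f y - f z + w \<bullet> (z - y)" by (simp add: inner_diff_right)
      also have "\<dots> \<le> (w - v) \<bullet> (z - y)" using lo by (simp add: inner_diff_left)
      also have "\<dots> \<le> norm (w - v) * norm (z - y)" by (rule norm_cauchy_schwarz)
      finally show ?thesis .
    qed
    have "norm (w - v) \<le> (\<Sum>b\<in>Basis. \<bar>(w - v) \<bullet> b\<bar>)" by (rule norm_le_l1)
    also have "\<dots> \<le> (\<Sum>b\<in>Basis. real n * (norm (w - v) * norm (z - y)) + second_diff b n y)"
    proof (rule sum_mono)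
      fix b :: 'a assume b: "b \<in> Basis"
      have "\<bar>(w - v) \<bullet> b\<bar> \<le> real n * (f y - (w \<bullet> y - g w)) + second_diff b n y"
        using v nS[OF b] n(1) by (rule gap_estimate)
      moreover have "real n * (f y - (w \<bullet> y - g w)) \<le> real n * (norm (w - v) * norm (z - y))"
        using gap by (intro mult_left_mono) auto
      ultimately show "\<bar>(w - v) \<bullet> b\<bar> \<le> real n * (norm (w - v) * norm (z - y)) + second_diff b n y" by linarith
    qed
    also have "\<dots> = norm (w - v) * (real n * ?d * norm (z - y)) + (\<Sum>b\<in>Basis. second_diff b n y)"
      by (simp add: sum.distrib)
    finally have le: "norm (w - v) \<le> norm (w - v) * (real n * ?d * norm (z - y)) + (\<Sum>b\<in>Basis. second_diff b n y)" .
    have "real n * ?d * norm (z - y) \<le> real n * ?d * inverse (2 * real n * ?d)"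
      using z by (intro mult_left_mono) (auto simp: \<delta>_def)
    also have "\<dots> = 1 / 2" using n(1) by (simp add: field_simps)
    finally have "norm (w - v) * (real n * ?d * norm (z - y)) \<le> norm (w - v) * (1 / 2)"
      by (intro mult_left_mono) auto
    with le n(2) have "norm (w - v) \<le> e" by linarith
    then have "norm (w - v) * norm (z - y) \<le> e * norm (z - y)" by (intro mult_right_mono) auto
    with lo up show ?thesis by auto
  qed
  ultimately show "\<exists>d>0. \<forall>z. norm (z - y) < d \<longrightarrow> norm (f z - f y - v \<bullet> (z - y)) \<le> e * norm (z - y)"
    by blast
qed

text \<open>For the direction from \<open>diff_at\<close>, the derivatives along \<open>b\<close>
  and \<open>- b\<close> cancel in the second difference; uniqueness of the derivative then
  identifies \<open>v\<close> with a maximizer.\<close>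

lemma diff_at_iff: "diff_at Psi y v \<longleftrightarrow> y \<in> smooth \<and> maximizer v y"
proof
  have ev: "(\<forall>\<^sub>F z in nhds y. \<bar>Psi z\<bar> \<noteq> \<infinity>) \<longleftrightarrow> y \<in> interior S"
    unfolding in_S_iff[symmetric] by (auto simp: eventually_nhds interior_def)
  have f: "f = (\<lambda>z. real_of_ereal (Psi z))" by (simp add: f_def[abs_def])
  show "diff_at Psi y v" if "y \<in> smooth \<and> maximizer v y"
    using that smooth_has_derivative[of y v]
    unfolding diff_at_def ev f by (auto simp: smooth_def)
  assume d: "diff_at Psi y v"
  then have yI: "y \<in> interior S" and der: "(f has_derivative (\<lambda>h. v \<bullet> h)) (at y)"
    unfolding diff_at_def ev f by auto
  obtain w where w: "maximizer w y" using maximizer_exists[OF yI] .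
  have "(\<lambda>n. second_diff b n y) \<longlonglongrightarrow> 0" if b: "b \<in> Basis" for b
  proof -
    have one: "(\<lambda>n. real n * (f (y + c /\<^sub>R real n) - f y)) \<longlonglongrightarrow> v \<bullet> c" for c
    proof -
      have line: "((\<lambda>t::real. y + t *\<^sub>R c) has_derivative (\<lambda>t. t *\<^sub>R c)) (at 0)"
        by (auto intro!: derivative_eq_intros)
      have "(f has_derivative (\<lambda>h. v \<bullet> h)) (at (y + 0 *\<^sub>R c))" using der by simp
      note has_derivative_compose[OF line this]
      then have "((\<lambda>t. f (y + t *\<^sub>R c)) has_field_derivative (v \<bullet> c)) (at 0)"
        by (rule has_derivative_imp_has_field_derivative) simp
      then have "((\<lambda>h. (f (y + h *\<^sub>R c) - f y) / h) \<longlongrightarrow> v \<bullet> c) (at 0)"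
        by (simp add: DERIV_def)
      moreover have "filterlim (\<lambda>n. inverse (real n)) (at 0) sequentially"
        unfolding filterlim_at
        by (auto simp: lim_inverse_n intro!: eventually_mono[OF eventually_gt_at_top[of 0]])
      ultimately have "(\<lambda>n. (f (y + inverse (real n) *\<^sub>R c) - f y) / inverse (real n)) \<longlonglongrightarrow> v \<bullet> c"
        by (rule filterlim_compose)
      then show ?thesis by (simp add: divide_inverse mult.commute)
    qed
    have "(\<lambda>n. real n * (f (y + b /\<^sub>R real n) - f y) + real n * (f (y + (- b) /\<^sub>R real n) - f y)) \<longlonglongrightarrow> v \<bullet> b + v \<bullet> (- b)"
      by (intro tendsto_add one)
    moreover have "real n * (f (y + b /\<^sub>R real n) - f y) + real n * (f (y + (- b) /\<^sub>R real n) - f y) = second_diff b n y" for n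
      by (simp add: second_diff_def algebra_simps)
    ultimately show ?thesis by simp
  qed
  then have ys: "y \<in> smooth" using yI by (auto simp: smooth_def)
  \<comment> \<open>Both derivatives are evaluated at the increment \<open>v - w\<close>, which
    makes its squared norm vanish.\<close>
  from has_derivative_unique[OF der smooth_has_derivative[OF ys w]] have "v \<bullet> (v - w) = w \<bullet> (v - w)"
    by (rule fun_cong)
  then have "(v - w) \<bullet> (v - w) = 0" by (simp add: inner_diff_left)
  then have "v = w" by simp
  with ys w show "y \<in> smooth \<and> maximizer v y" by simp
qed

lemma smooth_grad:
  assumes "y \<in> smooth"
  shows "maximizer (grad Psi y) y"
proof -
  obtain w where "maximizer w y" using maximizer_exists[of y] assms by (auto simp: smooth_def)
  then have ex: "\<exists>v. diff_at Psi y v" using assms by (auto simp: diff_at_iff)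
  then have "diff_at Psi y (SOME v. diff_at Psi y v)" by (rule someI_ex)
  then have "diff_at Psi y (grad Psi y)" using ex by (simp only: grad_def if_True)
  then show ?thesis by (simp add: diff_at_iff)
qed

lemma grad_not_smooth: "y \<notin> smooth \<Longrightarrow> grad Psi y = 0"
  by (simp add: grad_def diff_at_iff)

lemma smooth_borel [measurable]: "smooth \<in> sets borel"
proof -
  have [measurable]: "interior S \<in> sets borel" by simp
  have [measurable]: "finite (Basis :: 'a set)" by simp
  have "smooth = interior S \<inter> (\<Inter>b\<in>Basis. {y. (\<lambda>n. second_diff b n y) \<longlonglongrightarrow> 0})"
    unfolding smooth_def by auto
  moreover have "{y. (\<lambda>n. second_diff b n y) \<longlonglongrightarrow> 0} \<in> sets borel" for b
    using sets_tendsto_zero[of "second_diff b" borel] by simp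
  ultimately show ?thesis by auto
qed

text \<open>\<open>grad\<close> is built from \<open>SOME\<close>, so measurability is obtained by
  exhibiting it as a pointwise limit of forward difference quotients; the \<open>else\<close> branch
  matches the default 0 of \<open>grad\<close>.\<close>

lemma grad_borel [measurable]: "grad Psi \<in> borel_measurable borel"
proof (rule borel_measurable_LIMSEQ_metric)
  fix n show "(\<lambda>y. if y \<in> smooth then \<Sum>b\<in>Basis. (real n * (f (y + b /\<^sub>R real n) - f y)) *\<^sub>R b else 0) \<in> borel_measurable borel"
    by measurable
next
  fix y :: 'a
  show "(\<lambda>n. if y \<in> smooth then \<Sum>b\<in>Basis. (real n * (f (y + b /\<^sub>R real n) - f y)) *\<^sub>R b else 0) \<longlonglongrightarrow> grad Psi y"
  proof (cases "y \<in> smooth")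
    case True
    let ?v = "grad Psi y"
    have v: "maximizer ?v y" by (rule smooth_grad[OF True])
    have "(\<lambda>n. real n * (f (y + b /\<^sub>R real n) - f y)) \<longlonglongrightarrow> ?v \<bullet> b" if b: "b \<in> Basis" for b
    \<comment> \<open>The subgradient inequality at the forward point gives the lower bound; the one
      at the backward point bounds the forward quotient from above up to the second
      difference.\<close>
    proof (rule real_tendsto_sandwich[where f = "\<lambda>n. ?v \<bullet> b" and h = "\<lambda>n. ?v \<bullet> b + second_diff b n y"])
      obtain N where N: "N > 0" "\<And>n. n \<ge> N \<Longrightarrow> y + b /\<^sub>R real n \<in> interior S \<and> y - b /\<^sub>R real n \<in> interior S"
        using interior_shift[OF _ norm_Basis[OF b], of y] True by (auto simp: smooth_def)
      have *: "?v \<bullet> b \<le> real n * (f (y + b /\<^sub>R real n) - f y) \<and> real n * (f (y + b /\<^sub>R real n) - f y) \<le> ?v \<bullet> b + second_diff b n y" if "n \<ge> N" for n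
      proof -
        have n: "n > 0" using that N by auto
        let ?c = "b /\<^sub>R real n"
        have S: "y + ?c \<in> S" "y - ?c \<in> S" using N(2)[OF that] interior_subset by auto
        have "f y + ?v \<bullet> ?c \<le> f (y + ?c)" "f y - ?v \<bullet> ?c \<le> f (y - ?c)"
          using subgradient[OF v S(1)] subgradient[OF v S(2)] by (auto simp: inner_diff_right)
        then have "real n * (?v \<bullet> ?c) \<le> real n * (f (y + ?c) - f y)"
            "real n * (f (y + ?c) - f y) \<le> real n * (?v \<bullet> ?c + (f (y + ?c) + f (y - ?c) - 2 * f y))"
          by (auto intro!: mult_left_mono)
        moreover have "real n * (?v \<bullet> ?c) = ?v \<bullet> b" using n by simp
        ultimately show ?thesis unfolding second_diff_def distrib_left by linarith
      qed
      show "\<forall>\<^sub>F n in sequentially. ?v \<bullet> b \<le> real n * (f (y + b /\<^sub>R real n) - f y)"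
        "\<forall>\<^sub>F n in sequentially. real n * (f (y + b /\<^sub>R real n) - f y) \<le> ?v \<bullet> b + second_diff b n y"
        using * by (auto intro!: eventually_sequentiallyI[of N])
      have "(\<lambda>n. ?v \<bullet> b + second_diff b n y) \<longlonglongrightarrow> ?v \<bullet> b + 0"
        using True b by (intro tendsto_intros) (auto simp: smooth_def)
      then show "(\<lambda>n. ?v \<bullet> b + second_diff b n y) \<longlonglongrightarrow> ?v \<bullet> b" by simp
    qed simp
    then have "(\<lambda>n. \<Sum>b\<in>Basis. (real n * (f (y + b /\<^sub>R real n) - f y)) *\<^sub>R b) \<longlonglongrightarrow> (\<Sum>b\<in>Basis. (?v \<bullet> b) *\<^sub>R b)"
      by (intro tendsto_intros)
    then show ?thesis using True by (simp add: euclidean_representation)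
  qed (simp add: grad_not_smooth)
qed

text \<open>On a line a selection of maximizers is monotone, hence has countably many discontinuities.\<close>

lemma nonsmooth_line_countable:
  assumes b: "norm b = 1"
  shows "countable {t. y + t *\<^sub>R b \<in> interior S \<and> \<not> (\<lambda>n. second_diff b n (y + t *\<^sub>R b)) \<longlonglongrightarrow> 0}"
proof -
  define X where "X z = (SOME v. maximizer v z)" for z
  have X: "maximizer (X z) z" if "z \<in> interior S" for z
    unfolding X_def using maximizer_exists[OF that] by (metis someI_ex)
  define I where "I = {t. y + t *\<^sub>R b \<in> interior S}"
  define s where "s t = X (y + t *\<^sub>R b) \<bullet> b" for t
  have "open I"
  proof -
    have "open ((\<lambda>t. y + t *\<^sub>R b) -` interior S)"
      by (intro open_vimage open_interior continuous_intros)
    then show ?thesis by (simp add: I_def vimage_def)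
  qed
  moreover have "mono_on I s"
  proof (rule mono_onI)
    fix t u assume tu: "t \<in> I" "u \<in> I" "t \<le> u"
    let ?z = "y + t *\<^sub>R b" and ?w = "y + u *\<^sub>R b"
    have I: "?z \<in> interior S" "?w \<in> interior S" using tu by (auto simp: I_def)
    then have S: "?z \<in> S" "?w \<in> S" using interior_subset by auto
    have "f ?z + X ?z \<bullet> (?w - ?z) \<le> f ?w" "f ?w + X ?w \<bullet> (?z - ?w) \<le> f ?z"
      using subgradient[OF X[OF I(1)] S(2)] subgradient[OF X[OF I(2)] S(1)] by auto
    moreover have "?w - ?z = (u - t) *\<^sub>R b" "?z - ?w = - ((u - t) *\<^sub>R b)" by (auto simp: algebra_simps)
    ultimately have "(u - t) * s t \<le> (u - t) * s u" by (simp add: s_def)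
    then show "s t \<le> s u" using tu(3) by (cases "t = u") auto
  qed
  ultimately have "countable {t \<in> I. \<not> isCont s t}" by (rule mono_on_ctble_discont_open)
  moreover have "(\<lambda>n. second_diff b n (y + t *\<^sub>R b)) \<longlonglongrightarrow> 0" if t: "t \<in> I" "isCont s t" for t
  proof -
    let ?z = "y + t *\<^sub>R b"
    have zI: "?z \<in> interior S" using t by (simp add: I_def)
    obtain N where N: "N > 0" "\<And>n. n \<ge> N \<Longrightarrow> ?z + b /\<^sub>R real n \<in> interior S \<and> ?z - b /\<^sub>R real n \<in> interior S"
      using interior_shift[OF zI b] by blast
    \<comment> \<open>Subgradient inequalities at the midpoint give the lower bound, those at the
      two shifted points the upper bound; continuity of \<open>s\<close> at \<open>t\<close> then
      forces the limit 0.\<close>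
    have *: "0 \<le> second_diff b n ?z \<and> second_diff b n ?z \<le> s (t + inverse (real n)) - s (t - inverse (real n))" if "n \<ge> N" for n
    proof -
      let ?p = "?z + b /\<^sub>R real n" and ?m = "?z - b /\<^sub>R real n"
      have n: "n > 0" and I: "?p \<in> interior S" "?m \<in> interior S" using that N by auto
      then have S: "?z \<in> S" "?p \<in> S" "?m \<in> S" using zI interior_subset by auto
      have sX: "X ?p \<bullet> b = s (t + inverse (real n))" "X ?m \<bullet> b = s (t - inverse (real n))"
        by (simp_all add: s_def algebra_simps)
      have "f ?z + X ?z \<bullet> (?p - ?z) \<le> f ?p" "f ?z + X ?z \<bullet> (?m - ?z) \<le> f ?m"
        using subgradient[OF X[OF zI] S(2)] subgradient[OF X[OF zI] S(3)] by auto
      then have "0 \<le> f ?p + f ?m - 2 * f ?z" by simp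
      then have lo: "0 \<le> second_diff b n ?z" unfolding second_diff_def by (intro mult_nonneg_nonneg) auto
      have "f ?p + X ?p \<bullet> (?z - ?p) \<le> f ?z" "f ?m + X ?m \<bullet> (?z - ?m) \<le> f ?z"
        using subgradient[OF X[OF I(1)] S(1)] subgradient[OF X[OF I(2)] S(1)] by auto
      then have "f ?p + f ?m - 2 * f ?z \<le> inverse (real n) * (X ?p \<bullet> b) - inverse (real n) * (X ?m \<bullet> b)"
        by simp
      then have "real n * (f ?p + f ?m - 2 * f ?z) \<le> real n * (inverse (real n) * (X ?p \<bullet> b) - inverse (real n) * (X ?m \<bullet> b))"
        by (intro mult_left_mono) auto
      also have "\<dots> = X ?p \<bullet> b - X ?m \<bullet> b" using n by (simp add: right_diff_distrib mult.assoc[symmetric])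
      finally show ?thesis using lo unfolding sX second_diff_def by auto
    qed
    have "(\<lambda>n. s (t + inverse (real n)) - s (t - inverse (real n))) \<longlonglongrightarrow> s t - s t"
    proof (intro tendsto_diff isCont_tendsto_compose[OF t(2)])
      show "(\<lambda>n. t + inverse (real n)) \<longlonglongrightarrow> t" "(\<lambda>n. t - inverse (real n)) \<longlonglongrightarrow> t"
        using tendsto_add[OF tendsto_const[of t] lim_inverse_n] tendsto_diff[OF tendsto_const[of t] lim_inverse_n] by auto
    qed
    then have lim: "(\<lambda>n. s (t + inverse (real n)) - s (t - inverse (real n))) \<longlonglongrightarrow> 0" by simp
    show ?thesis
      by (rule real_tendsto_sandwich[OF _ _ tendsto_const lim])
         (use * in \<open>auto intro!: eventually_sequentiallyI[of N]\<close>)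
  qed
  ultimately show ?thesis
    by (rule_tac countable_subset[rotated]) (auto simp: I_def)
qed

text \<open>Translation invariance along \<open>b\<close> and Tonelli's theorem replace a choice of coordinates.\<close>

lemma nonsmooth_null:
  assumes b: "norm b = 1"
  shows "{y \<in> interior S. \<not> (\<lambda>n. second_diff b n y) \<longlonglongrightarrow> 0} \<in> null_sets lborel"
proof -
  define N where "N = {y \<in> interior S. \<not> (\<lambda>n. second_diff b n y) \<longlonglongrightarrow> 0}"
  have "N = interior S - {y. (\<lambda>n. second_diff b n y) \<longlonglongrightarrow> 0}" by (auto simp: N_def)
  moreover have "{y. (\<lambda>n. second_diff b n y) \<longlonglongrightarrow> 0} \<in> sets borel"
    using sets_tendsto_zero[of "second_diff b" borel] by simp
  ultimately have N [measurable]: "N \<in> sets borel" by auto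
  have shift: "(\<integral>\<^sup>+y. indicator N (y + t *\<^sub>R b) \<partial>lborel) = emeasure lborel N" for t
  proof -
    have "emeasure lborel N = (\<integral>\<^sup>+y. indicator N y \<partial>distr lborel borel ((+) (t *\<^sub>R b)))"
      by (simp add: lborel_distr_plus)
    also have "\<dots> = (\<integral>\<^sup>+y. indicator N (y + t *\<^sub>R b) \<partial>lborel)"
      by (subst nn_integral_distr) (auto simp: add.commute)
    finally show ?thesis by simp
  qed
  have line: "(\<integral>\<^sup>+t. indicator {0..1} t * indicator N (y + t *\<^sub>R b) \<partial>lborel) = 0" for y
  proof -
    have "countable {t. y + t *\<^sub>R b \<in> N}"
      using nonsmooth_line_countable[OF b, of y] by (simp add: N_def)
    then have "{t. y + t *\<^sub>R b \<in> N} \<in> null_sets lborel" by (rule countable_imp_null_set_lborel)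
    then have "AE t in lborel. t \<notin> {t. y + t *\<^sub>R b \<in> N}" by (rule AE_not_in)
    then have "AE t in lborel. indicator {0..1} t * indicator N (y + t *\<^sub>R b) = (0::ennreal)"
      by eventually_elim auto
    then show ?thesis by (subst nn_integral_0_iff_AE) auto
  qed
  \<comment> \<open>The unit interval has length 1, so the measure of \<open>N\<close> is the
    average of the measures of its translates along \<open>b\<close>; exchanging the integrals
    leaves intersections with lines, which are null.\<close>
  have "emeasure lborel N = (\<integral>\<^sup>+t. indicator {0..1::real} t * emeasure lborel N \<partial>lborel)"
    by (simp add: nn_integral_multc)
  also have "\<dots> = (\<integral>\<^sup>+t. (\<integral>\<^sup>+y. indicator {0..1} t * indicator N (y + t *\<^sub>R b) \<partial>lborel) \<partial>lborel)"
    by (subst nn_integral_cmult) (auto simp: shift)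
  also have "\<dots> = (\<integral>\<^sup>+y. (\<integral>\<^sup>+t. indicator {0..1} t * indicator N (y + t *\<^sub>R b) \<partial>lborel) \<partial>lborel)"
    by (rule lborel_pair.Fubini') measurable
  also have "\<dots> = 0" by (simp add: line)
  finally show ?thesis using N by (auto simp: N_def null_sets_def)
qed

text \<open>A nonsmooth point of \<open>S\<close> lies on the frontier of the convex set
  \<open>S\<close>, which is negligible, or fails the criterion along one of finitely many basis
  vectors.\<close>

lemma AE_smooth: "AE y in lborel. y \<in> S \<longrightarrow> y \<in> smooth"
proof -
  have "frontier S \<in> null_sets lebesgue"
    using negligible_convex_frontier[OF convex_S] by (simp add: negligible_iff_null_sets)
  then have "frontier S \<in> null_sets lborel"
    by (subst (asm) null_sets_completion_iff) auto
  moreover have "(\<Union>b\<in>Basis. {y \<in> interior S. \<not> (\<lambda>n. second_diff b n y) \<longlonglongrightarrow> 0}) \<in> null_sets lborel"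
    by (intro null_sets_UN' countable_finite nonsmooth_null) auto
  ultimately have "frontier S \<union> (\<Union>b\<in>Basis. {y \<in> interior S. \<not> (\<lambda>n. second_diff b n y) \<longlonglongrightarrow> 0}) \<in> null_sets lborel"
    by (rule null_sets.Un)
  then have "AE y in lborel. y \<notin> frontier S \<union> (\<Union>b\<in>Basis. {y \<in> interior S. \<not> (\<lambda>n. second_diff b n y) \<longlonglongrightarrow> 0})"
    by (rule AE_not_in)
  then show ?thesis
    by eventually_elim (use closure_subset in \<open>auto simp: smooth_def frontier_def\<close>)
qed

end

section \<open>Integration and the quadratic sup-convolution\<close>

text \<open>A finite convex function on a Euclidean space is continuous, which gives lower
  semicontinuity; properness follows from finiteness.\<close>

lemma A_cx_real_iff:
  fixes u :: "'a::euclidean_space \<Rightarrow> real"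
  shows "(\<lambda>x. ereal (u x)) \<in> A_cx \<longleftrightarrow> convex_on UNIV u"
proof
  assume "(\<lambda>x. ereal (u x)) \<in> A_cx"
  then have *: "u (t *\<^sub>R x + (1 - t) *\<^sub>R y) \<le> t * u x + (1 - t) * u y" if "0 < t" "t < 1" for x y t
    using that by (auto simp: A_cx_def ereal_convex_def)
  show "convex_on UNIV u"
  proof (rule convex_onI)
    fix t :: real and x y assume "0 < t" "t < 1"
    then show "u ((1 - t) *\<^sub>R x + t *\<^sub>R y) \<le> (1 - t) * u x + t * u y"
      using *[of "1 - t" x y] by simp
  qed simp
next
  assume c: "convex_on UNIV u"
  then have "continuous_on UNIV u" by (intro convex_on_continuous) auto
  then have "lsc (\<lambda>x. ereal (u x))"
    using lsc_SUP_continuous[of "{()}" "\<lambda>_. u"] by simp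
  moreover have "ereal_convex (\<lambda>x. ereal (u x))"
    using c by (auto simp: ereal_convex_def convex_on_def)
  ultimately show "(\<lambda>x. ereal (u x)) \<in> A_cx"
    by (auto simp: A_cx_def proper_fun_def)
qed

lemma P2_integrable_norm_sq:
  assumes "\<mu> \<in> P2"
  shows "integrable \<mu> (\<lambda>x. norm x ^ 2)"
proof -
  have [measurable_cong]: "sets \<mu> = sets borel" using assms by (simp add: P2_def)
  show ?thesis
    using assms by (intro integrableI_nonneg) (auto simp: P2_def)
qed

lemma P2_integrable:
  fixes u :: "'a::euclidean_space \<Rightarrow> real"
  assumes mu: "\<mu> \<in> P2" and u: "u \<in> borel_measurable borel" "\<And>x. \<bar>u x\<bar> \<le> C * (1 + norm x ^ 2)"
  shows "integrable \<mu> u"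
proof (rule Bochner_Integration.integrable_bound)
  interpret prob_space \<mu> using mu by (simp add: P2_def)
  have [measurable_cong]: "sets \<mu> = sets borel" using mu by (simp add: P2_def)
  show "integrable \<mu> (\<lambda>x. C * (1 + norm x ^ 2))"
    using P2_integrable_norm_sq[OF mu] by simp
  show "u \<in> borel_measurable \<mu>" using u(1) by measurable
  show "AE x in \<mu>. norm (u x) \<le> norm (C * (1 + norm x ^ 2))"
    using u(2) by (auto intro: order_trans[OF _ abs_ge_self])
qed

lemma integrable_sandwich:
  fixes l u v :: "'a \<Rightarrow> real"
  assumes "integrable M l" "integrable M u" "v \<in> borel_measurable M"
    and "AE x in M. l x \<le> v x" "AE x in M. v x \<le> u x"
  shows "integrable M v"
proof (rule Bochner_Integration.integrable_bound)
  show "integrable M (\<lambda>x. \<bar>l x\<bar> + \<bar>u x\<bar>)" using assms by simp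
  show "AE x in M. norm (v x) \<le> norm (\<bar>l x\<bar> + \<bar>u x\<bar>)"
    using assms(4,5) by eventually_elim auto
qed fact

lemma eint_eq_integral:
  assumes q: "integrable M q" and F: "AE x in M. F x = ereal (q x)"
  shows "eint M F = ereal (\<integral>x. q x \<partial>M)"
proof -
  have "eint_pos M F = (\<integral>\<^sup>+x. ennreal (q x) \<partial>M)" "eint_neg M F = (\<integral>\<^sup>+x. ennreal (- q x) \<partial>M)"
    unfolding eint_pos_def eint_neg_def
    by (intro nn_integral_cong_AE; use F in eventually_elim; simp)+
  moreover have "(\<integral>\<^sup>+x. ennreal (q x) \<partial>M) \<noteq> \<infinity>" "(\<integral>\<^sup>+x. ennreal (- q x) \<partial>M) \<noteq> \<infinity>"
    using q by (auto simp: real_integrable_def)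
  ultimately show ?thesis
    unfolding eint_def real_lebesgue_integral_def[OF q]
    by (cases "\<integral>\<^sup>+x. ennreal (q x) \<partial>M"; cases "\<integral>\<^sup>+x. ennreal (- q x) \<partial>M") auto
qed

text \<open>The integrable minorant makes the negative part finite, and then an infinite positive
  part would make \<open>eint\<close> infinite.\<close>

lemma eint_finite_imp_integrable:
  assumes F [measurable]: "F \<in> borel_measurable M"
    and l: "integrable M l" "AE x in M. ereal (l x) \<le> F x"
    and fin: "eint M F \<noteq> \<infinity>"
  shows "integrable M (\<lambda>x. real_of_ereal (F x))" and "AE x in M. \<bar>F x\<bar> \<noteq> \<infinity>"
proof -
  have "eint_neg M F \<le> (\<integral>\<^sup>+x. ennreal (- l x) \<partial>M)"
    unfolding eint_neg_def
  proof (rule nn_integral_mono_AE)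
    show "AE x in M. e2ennreal (- F x) \<le> ennreal (- l x)"
      using l(2)
    proof eventually_elim
      case (elim x)
      then have "- F x \<le> ereal (- l x)" by (metis ereal_minus_le_minus uminus_ereal.simps(1))
      then show ?case using e2ennreal_mono e2ennreal_ereal by metis
    qed
  qed
  also have "\<dots> < \<infinity>" using l(1) by (auto simp: real_integrable_def top.not_eq_extremum)
  finally have neg: "eint_neg M F \<noteq> \<infinity>" by simp
  have pos: "eint_pos M F \<noteq> \<infinity>"
  proof
    assume "eint_pos M F = \<infinity>"
    then have "eint M F = \<infinity>" using neg unfolding eint_def by (cases "eint_neg M F") auto
    with fin show False by simp
  qed
  have "AE x in M. e2ennreal (F x) \<noteq> \<infinity>"
    using pos unfolding eint_pos_def by (intro nn_integral_PInf_AE) auto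
  with l(2) show ae: "AE x in M. \<bar>F x\<bar> \<noteq> \<infinity>"
  proof eventually_elim
    case (elim x) then show ?case by (cases "F x") auto
  qed
  have "eint_pos M F = (\<integral>\<^sup>+x. ennreal (real_of_ereal (F x)) \<partial>M)"
    unfolding eint_pos_def
  proof (intro nn_integral_cong_AE)
    show "AE x in M. e2ennreal (F x) = ennreal (real_of_ereal (F x))"
      using ae
    proof eventually_elim
      case (elim x) then show ?case by (cases "F x") auto
    qed
  qed
  moreover have "eint_neg M F = (\<integral>\<^sup>+x. ennreal (- real_of_ereal (F x)) \<partial>M)"
    unfolding eint_neg_def
  proof (intro nn_integral_cong_AE)
    show "AE x in M. e2ennreal (- F x) = ennreal (- real_of_ereal (F x))"
      using ae
    proof eventually_elim
      case (elim x) then show ?case by (cases "F x") auto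
    qed
  qed
  ultimately show "integrable M (\<lambda>x. real_of_ereal (F x))"
    using pos neg by (simp add: real_integrable_def)
qed

text \<open>Fatou's lemma for the nonnegative functions \<open>u n - l\<close>; the bound
  \<open>K\<close> passes to the limit and yields integrability as well.\<close>

lemma integral_fatou:
  fixes u :: "nat \<Rightarrow> 'a \<Rightarrow> real"
  assumes u: "\<And>n. integrable M (u n)" and l: "integrable M l"
    and lu: "\<And>n. AE x in M. l x \<le> u n x" and K: "\<And>n. (\<integral>x. u n x \<partial>M) \<le> K"
    and lim: "AE x in M. (\<lambda>n. u n x) \<longlonglongrightarrow> v x" and v: "v \<in> borel_measurable M"
  shows "integrable M v" and "(\<integral>x. v x \<partial>M) \<le> K"
proof -
  have [measurable]: "u n \<in> borel_measurable M" "l \<in> borel_measurable M" "v \<in> borel_measurable M" for n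
    using u l v by auto
  have lv: "AE x in M. l x \<le> v x"
  proof -
    have "AE x in M. \<forall>n. l x \<le> u n x" using lu by (simp add: AE_all_countable)
    with lim show ?thesis
    proof eventually_elim
      case (elim x) then show ?case by (intro LIMSEQ_le_const[OF elim(1)]) auto
    qed
  qed
  \<comment> \<open>This keeps \<open>K - (\<integral>x. l x \<partial>M)\<close> nonnegative, so
    that passing through \<open>ennreal\<close> truncates nothing.\<close>
  have lK: "(\<integral>x. l x \<partial>M) \<le> K"
    using integral_mono_AE[OF l u lu, of 0] K[of 0] by linarith
  have "(\<integral>\<^sup>+x. ennreal (v x - l x) \<partial>M) = (\<integral>\<^sup>+x. liminf (\<lambda>n. ennreal (u n x - l x)) \<partial>M)"
  proof (intro nn_integral_cong_AE)
    show "AE x in M. ennreal (v x - l x) = liminf (\<lambda>n. ennreal (u n x - l x))"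
      using lim
    proof eventually_elim
      case (elim x)
      have "(\<lambda>n. ennreal (u n x - l x)) \<longlonglongrightarrow> ennreal (v x - l x)"
        by (intro tendsto_ennrealI tendsto_diff elim tendsto_const)
      then show ?case by (simp add: lim_imp_Liminf)
    qed
  qed
  also have "\<dots> \<le> liminf (\<lambda>n. \<integral>\<^sup>+x. ennreal (u n x - l x) \<partial>M)"
    by (intro nn_integral_liminf) auto
  also have "\<dots> \<le> ennreal (K - (\<integral>x. l x \<partial>M))"
  proof (intro Liminf_le always_eventually allI)
    fix n
    have "(\<integral>\<^sup>+x. ennreal (u n x - l x) \<partial>M) = ennreal (\<integral>x. u n x - l x \<partial>M)"
      using lu[of n] u l by (intro nn_integral_eq_integral) auto
    also have "\<dots> = ennreal ((\<integral>x. u n x \<partial>M) - (\<integral>x. l x \<partial>M))"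
      using u l by simp
    also have "\<dots> \<le> ennreal (K - (\<integral>x. l x \<partial>M))"
      using K[of n] by (intro ennreal_leI) auto
    finally show "(\<integral>\<^sup>+x. ennreal (u n x - l x) \<partial>M) \<le> ennreal (K - (\<integral>x. l x \<partial>M))" .
  qed simp
  finally have le: "(\<integral>\<^sup>+x. ennreal (v x - l x) \<partial>M) \<le> ennreal (K - (\<integral>x. l x \<partial>M))" .
  have int: "integrable M (\<lambda>x. v x - l x)"
    using lv le_less_trans[OF le ennreal_less_top] by (intro integrableI_nonneg) (auto simp: less_top)
  from Bochner_Integration.integrable_add[OF int l] show v': "integrable M v" by simp
  have "ennreal (\<integral>x. v x - l x \<partial>M) \<le> ennreal (K - (\<integral>x. l x \<partial>M))"
    using le lv by (subst (asm) nn_integral_eq_integral[OF int]) auto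
  then have "(\<integral>x. v x - l x \<partial>M) \<le> K - (\<integral>x. l x \<partial>M)"
    using lK by (simp add: ennreal_le_iff)
  then show "(\<integral>x. v x \<partial>M) \<le> K"
    using v' l by simp
qed

section \<open>Squared distances and elementary bounds on the sup-convolution\<close>

lemma norm_diff_sq_eq:
  fixes x y :: "'a::real_inner"
  shows "norm (x - y) ^ 2 = norm x ^ 2 - 2 * (x \<bullet> y) + norm y ^ 2"
  by (simp add: power2_norm_eq_inner inner_diff_left inner_diff_right inner_commute)

lemma norm_diff_sq_le:
  fixes x y :: "'a::real_inner"
  shows "norm (x - y) ^ 2 \<le> 2 * norm x ^ 2 + 2 * norm y ^ 2"
proof -
  have "norm (x + y) ^ 2 = norm x ^ 2 + 2 * (x \<bullet> y) + norm y ^ 2"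
    using norm_diff_sq_eq[of x "- y"] by simp
  moreover have "0 \<le> norm (x + y) ^ 2" by simp
  ultimately show ?thesis using norm_diff_sq_eq[of x y] by linarith
qed

lemma Qbar2_borel [measurable]: "Qbar2 u \<in> borel_measurable borel"
  unfolding Qbar2_def[abs_def] by (intro borel_measurable_SUP_continuous continuous_intros)

lemma Qbar2_ge: "ereal (u x - norm (x - y) ^ 2) \<le> Qbar2 u y"
  unfolding Qbar2_def by (rule SUP_upper) auto

lemma Qbar2_le: "(\<And>x. u x - norm (x - y) ^ 2 \<le> c) \<Longrightarrow> Qbar2 u y \<le> ereal c"
  unfolding Qbar2_def by (rule SUP_least) auto

section \<open>First-order optimality\<close>

locale dual_optimizer =
  fixes \<mu> \<nu> :: "'a::euclidean_space measure" and \<phi> :: "'a \<Rightarrow> real" and C :: real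
  assumes mu: "\<mu> \<in> P2" and nu: "\<nu> \<in> P2"
    and nu_ac: "absolutely_continuous lborel \<nu>"
    and convex_phi: "convex_on UNIV \<phi>"
    and growth_phi: "\<And>x. \<bar>\<phi> x\<bar> \<le> C * (1 + norm x ^ 2)"
    and optimal: "dual_obj \<mu> \<nu> \<phi> = D2 \<mu> \<nu>"
begin

lemma continuous_phi: "continuous_on UNIV \<phi>"
  using convex_phi by (intro convex_on_continuous) auto

lemma phi_borel [measurable]: "\<phi> \<in> borel_measurable borel"
  using continuous_phi by (rule borel_measurable_continuous_onI)

text \<open>In this instance \<open>Psi\<close> is the transform of \<open>phi0\<close> from the
  theorem, and its gradient \<open>T\<close> is the candidate transport map.\<close>

sublocale conjugate "\<lambda>x. norm x ^ 2 / 2 - \<phi> x / 2"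
  by unfold_locales (intro continuous_intros continuous_phi, auto)

sublocale \<mu>: prob_space \<mu> using mu by (simp add: P2_def)
sublocale \<nu>: prob_space \<nu> using nu by (simp add: P2_def)

lemma sets_mu [measurable_cong]: "sets \<mu> = sets borel" using mu by (simp add: P2_def)
lemma sets_nu [measurable_cong]: "sets \<nu> = sets borel" using nu by (simp add: P2_def)

text \<open>The finite version of \<open>Qbar2 \<phi>\<close>, valid on \<open>S\<close> by
  \<open>Qbar2_phi_S\<close>.\<close>

definition "q y = 2 * f y - norm y ^ 2"
definition "gap x y = f y - (x \<bullet> y - (norm x ^ 2 / 2 - \<phi> x / 2))"
abbreviation "T \<equiv> grad Psi"

lemma q_borel [measurable]: "q \<in> borel_measurable borel"
  unfolding q_def[abs_def] by measurable

lemma gap_nonneg: "y \<in> S \<Longrightarrow> 0 \<le> gap x y"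
  unfolding gap_def using young[of y x] by simp

lemma cost_eq: "norm (x - y) ^ 2 = \<phi> x - q y + 2 * gap x y"
  unfolding norm_diff_sq_eq gap_def q_def by (simp add: field_simps)

lemma gap_maximizer: "maximizer v y \<Longrightarrow> gap v y = 0"
  by (simp add: gap_def maximizer_def)

lemma Qbar2_phi: "Qbar2 \<phi> y = 2 * Psi y - ereal (norm y ^ 2)"
proof -
  have *: "\<phi> x - norm (x - y) ^ 2 = 2 * (x \<bullet> y - (norm x ^ 2 / 2 - \<phi> x / 2)) - norm y ^ 2" for x
    unfolding norm_diff_sq_eq by (simp add: field_simps)
  show ?thesis
  proof (cases "y \<in> S")
    case True
    have "\<phi> x - norm (x - y) ^ 2 \<le> q y" for x
      unfolding * q_def by (intro diff_right_mono mult_left_mono young True) simp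
    then have "Qbar2 \<phi> y \<le> ereal (q y)" by (rule Qbar2_le)
    moreover have "ereal (q y) \<le> Qbar2 \<phi> y"
    proof (rule ereal_le_epsilon2)
      fix e :: real assume e: "0 < e"
      then obtain x where x: "f y - e / 2 < x \<bullet> y - (norm x ^ 2 / 2 - \<phi> x / 2)"
        using f_approx[OF True, of "e / 2"] by auto
      then have "q y \<le> \<phi> x - norm (x - y) ^ 2 + e"
        unfolding * q_def by simp
      then have "ereal (q y) \<le> ereal (\<phi> x - norm (x - y) ^ 2) + ereal e" by simp
      also have "\<dots> \<le> Qbar2 \<phi> y + ereal e" by (intro add_right_mono Qbar2_ge)
      finally show "ereal (q y) \<le> Qbar2 \<phi> y + ereal e" .
    qed
    ultimately show ?thesis using Psi_eq_f[OF True] by (simp add: q_def)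
  next
    case False
    then have P: "Psi y = \<infinity>" using in_S_iff[of y] Psi_not_MInf[of y] by auto
    have "Qbar2 \<phi> y = \<infinity>"
    proof (rule ccontr)
      assume "Qbar2 \<phi> y \<noteq> \<infinity>"
      then obtain c where c: "Qbar2 \<phi> y = ereal c" using Qbar2_ge[of \<phi> 0 y] by (cases "Qbar2 \<phi> y") auto
      have "Psi y \<le> ereal ((c + norm y ^ 2) / 2)"
      proof (rule Psi_le)
        fix x
        have "\<phi> x - norm (x - y) ^ 2 \<le> c" using Qbar2_ge[of \<phi> x y] c by simp
        then show "x \<bullet> y - (norm x ^ 2 / 2 - \<phi> x / 2) \<le> (c + norm y ^ 2) / 2" unfolding * by simp
      qed
      with P show False by simp
    qed
    with P show ?thesis by simp
  qed
qed

lemma Qbar2_phi_S: "y \<in> S \<Longrightarrow> Qbar2 \<phi> y = ereal (q y)"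
  by (simp add: Qbar2_phi Psi_eq_f q_def)

lemma integrable_phi_mu: "integrable \<mu> \<phi>"
  by (rule P2_integrable[OF mu phi_borel growth_phi])

lemma dual_obj_le: 
  assumes "convex_on UNIV u" "\<And>x. \<bar>u x\<bar> \<le> K * (1 + norm x ^ 2)"
  shows "dual_obj \<mu> \<nu> u \<le> dual_obj \<mu> \<nu> \<phi>"
proof -
  have "continuous_on UNIV u" using assms(1) by (intro convex_on_continuous) auto
  then have "u \<in> S_b2" using assms(2) by (auto simp: S_b2_def intro: borel_measurable_continuous_onI)
  then show ?thesis
    unfolding optimal D2_def using assms(1) by (intro SUP_upper) (auto simp: A_cx_real_iff)
qed

text \<open>The zero function is an admissible competitor of value 0. The bound rules out the value
  \<open>-\<infinity>\<close> for the optimizer.\<close>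

lemma dual_obj_nonneg: "0 \<le> dual_obj \<mu> \<nu> \<phi>"
proof -
  have "Qbar2 (\<lambda>x. 0) y = ereal 0" for y :: 'a
    using Qbar2_le[of "\<lambda>x. 0" y 0] Qbar2_ge[of "\<lambda>x. 0" y y] by (intro antisym) auto
  then have "eint \<nu> (Qbar2 (\<lambda>x. 0)) = ereal (\<integral>x. 0 \<partial>\<nu>)"
    by (intro eint_eq_integral) auto
  then have "dual_obj \<mu> \<nu> (\<lambda>x. 0) = 0" by (simp add: dual_obj_def)
  moreover have "dual_obj \<mu> \<nu> (\<lambda>x. 0) \<le> dual_obj \<mu> \<nu> \<phi>"
    by (rule dual_obj_le[where K = 0]) (auto simp: convex_on_const)
  ultimately show ?thesis by simp
qed

text \<open>As the optimal value is not \<open>-\<infinity>\<close>, the integral of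
  \<open>Qbar2 \<phi>\<close> is not \<open>\<infinity>\<close>; choosing \<open>x = y\<close> in
  the supremum shows that \<open>\<phi>\<close> is an integrable minorant.\<close>

lemma AE_S: "AE y in \<nu>. y \<in> S" and integrable_q: "integrable \<nu> q"
proof -
  have "eint \<nu> (Qbar2 \<phi>) \<noteq> \<infinity>" using dual_obj_nonneg by (auto simp: dual_obj_def)
  moreover have "ereal (\<phi> y) \<le> Qbar2 \<phi> y" for y using Qbar2_ge[of \<phi> y y] by simp
  moreover have "integrable \<nu> \<phi>" by (rule P2_integrable[OF nu phi_borel growth_phi])
  ultimately have *: "integrable \<nu> (\<lambda>y. real_of_ereal (Qbar2 \<phi> y))" "AE y in \<nu>. \<bar>Qbar2 \<phi> y\<bar> \<noteq> \<infinity>"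
    by (auto intro!: eint_finite_imp_integrable[where l = \<phi>])
  from *(2) show S: "AE y in \<nu>. y \<in> S"
  proof eventually_elim
    case (elim y)
    then have "\<bar>Psi y\<bar> \<noteq> \<infinity>" by (cases "Psi y") (auto simp: Qbar2_phi)
    then show ?case by (simp add: in_S_iff)
  qed
  have "AE y in \<nu>. real_of_ereal (Qbar2 \<phi> y) = q y"
    using S by eventually_elim (simp add: Qbar2_phi_S)
  with *(1) show "integrable \<nu> q"
    by (subst (asm) integrable_cong_AE) auto
qed

text \<open>Absolute continuity of \<open>\<nu>\<close> enters here, carrying smoothness from
  Lebesgue almost every point of \<open>S\<close> to \<open>\<nu>\<close>-almost every
  point.\<close>

lemma AE_smooth_nu: "AE y in \<nu>. y \<in> smooth"
proof -
  have "AE y in \<nu>. y \<in> S \<longrightarrow> y \<in> smooth"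
    by (rule absolutely_continuous_AE[OF _ nu_ac AE_smooth]) (simp add: sets_nu)
  with AE_S show ?thesis by eventually_elim simp
qed

lemma AE_maximizer: "AE y in \<nu>. maximizer (T y) y"
  using AE_smooth_nu by eventually_elim (rule smooth_grad)

lemma dual_value: "dual_obj \<mu> \<nu> \<phi> = ereal ((\<integral>x. \<phi> x \<partial>\<mu>) - (\<integral>y. q y \<partial>\<nu>))"
proof -
  have "eint \<nu> (Qbar2 \<phi>) = ereal (\<integral>y. q y \<partial>\<nu>)"
    using AE_S by (intro eint_eq_integral integrable_q) (auto simp: Qbar2_phi_S)
  then show ?thesis by (simp add: dual_obj_def)
qed

text \<open>This is the first-order condition in direction \<open>h - \<phi>\<close>. The integrable
  \<open>k\<close> keeps \<open>Qbar2\<close> finite along the variation and bounds the difference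
  quotients from above.\<close>

lemma variation:
  assumes convex_h: "convex_on UNIV h" and growth_h: "\<And>x. \<bar>h x\<bar> \<le> K * (1 + norm x ^ 2)"
    and k: "integrable \<nu> k" and hk: "\<And>x y. h x - norm (x - y) ^ 2 \<le> k y"
  shows "integrable \<nu> (\<lambda>y. h (T y) - \<phi> (T y))"
    and "(\<integral>x. h x \<partial>\<mu>) - (\<integral>x. \<phi> x \<partial>\<mu>) \<le> (\<integral>y. h (T y) - \<phi> (T y) \<partial>\<nu>)"
proof -
  have cont_h: "continuous_on UNIV h" using convex_h by (intro convex_on_continuous) auto
  then have h_borel [measurable]: "h \<in> borel_measurable borel" by (rule borel_measurable_continuous_onI)
  \<comment> \<open>Positive also at \<open>n = 0\<close>, and at most 1/2 as the absorption in
    \<open>gap_le\<close> requires.\<close>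
  define \<epsilon> where "\<epsilon> n = 1 / (real n + 2)" for n
  have \<epsilon>: "0 < \<epsilon> n" "\<epsilon> n \<le> 1 / 2" for n by (auto simp: \<epsilon>_def field_simps)
  have \<epsilon>_lim: "\<epsilon> \<longlonglongrightarrow> 0"
    unfolding \<epsilon>_def by real_asymp
  define u where "u n x = (1 - \<epsilon> n) * \<phi> x + \<epsilon> n * h x" for n x
  define r where "r n y = real_of_ereal (Qbar2 (u n) y)" for n y
  define d where "d n y = (r n y - q y) / \<epsilon> n" for n y
  have convex_u: "convex_on UNIV (u n)" for n
    unfolding u_def using \<epsilon>[of n] by (intro convex_on_add convex_on_cmul convex_phi convex_h) auto
  have growth_u: "\<bar>u n x\<bar> \<le> (\<bar>C\<bar> + \<bar>K\<bar>) * (1 + norm x ^ 2)" for n x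
  proof -
    have "\<bar>u n x\<bar> \<le> \<bar>(1 - \<epsilon> n) * \<phi> x\<bar> + \<bar>\<epsilon> n * h x\<bar>" unfolding u_def by (rule abs_triangle_ineq)
    also have "\<dots> \<le> \<bar>\<phi> x\<bar> + \<bar>h x\<bar>"
      using \<epsilon>[of n] unfolding abs_mult by (intro add_mono mult_left_le_one_le) auto
    also have "\<dots> \<le> \<bar>C\<bar> * (1 + norm x ^ 2) + \<bar>K\<bar> * (1 + norm x ^ 2)"
      using growth_phi[of x] growth_h[of x]
      by (intro add_mono order_trans[OF growth_phi] order_trans[OF growth_h] mult_right_mono) auto
    finally show ?thesis by (simp add: distrib_right)
  qed
  have u_borel [measurable]: "u n \<in> borel_measurable borel" for n
    unfolding u_def by measurable
  have r_borel [measurable]: "r n \<in> borel_measurable borel" for n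
    unfolding r_def by measurable
  \<comment> \<open>Convexity of \<open>Qbar2\<close> in its argument: the pointwise bounds for
    \<open>\<phi>\<close> and for \<open>h\<close> are mixed with weights
    \<open>1 - \<epsilon> n\<close> and \<open>\<epsilon> n\<close>.\<close>
  have u_le: "u n x - norm (x - y) ^ 2 \<le> (1 - \<epsilon> n) * q y + \<epsilon> n * k y" if "y \<in> S" for n x y
  proof -
    have "\<phi> x - norm (x - y) ^ 2 \<le> q y" using cost_eq[of x y] gap_nonneg[OF that, of x] by linarith
    then have "(1 - \<epsilon> n) * (\<phi> x - norm (x - y) ^ 2) + \<epsilon> n * (h x - norm (x - y) ^ 2) \<le> (1 - \<epsilon> n) * q y + \<epsilon> n * k y"
      using \<epsilon>[of n] hk[of x y] by (intro add_mono mult_left_mono) auto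
    then show ?thesis unfolding u_def by (simp add: algebra_simps)
  qed
  have Q_u: "Qbar2 (u n) y = ereal (r n y)" if "y \<in> S" for n y
    unfolding r_def using Qbar2_le[of "u n" y, OF u_le[OF that]] Qbar2_ge[of "u n" y y]
    by (cases "Qbar2 (u n) y") auto
  have r_ge: "u n x - norm (x - y) ^ 2 \<le> r n y" if "y \<in> S" for n x y
    using Qbar2_ge[of "u n" x y] by (simp add: Q_u[OF that])
  have r_le: "r n y \<le> (1 - \<epsilon> n) * q y + \<epsilon> n * k y" if "y \<in> S" for n y
    using Qbar2_le[of "u n" y, OF u_le[OF that, of n]] by (simp add: Q_u[OF that])
  have r_int: "integrable \<nu> (r n)" for n
  proof (rule integrable_sandwich)
    show "integrable \<nu> (u n)" by (rule P2_integrable[OF nu u_borel growth_u])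
    show "integrable \<nu> (\<lambda>y. (1 - \<epsilon> n) * q y + \<epsilon> n * k y)" using integrable_q k by simp
    have "u n y \<le> r n y" if "y \<in> S" for y using r_ge[OF that, of n y] by simp
    then show "AE y in \<nu>. u n y \<le> r n y" using AE_S by auto
    show "AE y in \<nu>. r n y \<le> (1 - \<epsilon> n) * q y + \<epsilon> n * k y"
      using AE_S by eventually_elim (rule r_le)
  qed measurable
  have h_mu: "integrable \<mu> h" by (rule P2_integrable[OF mu h_borel growth_h])
  define \<Delta> where "\<Delta> = (\<integral>x. h x \<partial>\<mu>) - (\<integral>x. \<phi> x \<partial>\<mu>)"
  \<comment> \<open>Optimality of \<open>\<phi>\<close> against the competitor \<open>u n\<close>,
    divided by \<open>\<epsilon> n\<close>.\<close>
  have d_ge: "\<Delta> \<le> (\<integral>y. d n y \<partial>\<nu>)" for n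
  proof -
    have "eint \<nu> (Qbar2 (u n)) = ereal (\<integral>y. r n y \<partial>\<nu>)"
      by (rule eint_eq_integral[OF r_int]) (use AE_S in eventually_elim, rule Q_u)
    then have "(\<integral>x. u n x \<partial>\<mu>) - (\<integral>y. r n y \<partial>\<nu>) \<le> (\<integral>x. \<phi> x \<partial>\<mu>) - (\<integral>y. q y \<partial>\<nu>)"
      using dual_obj_le[OF convex_u growth_u, of n] unfolding dual_value by (simp add: dual_obj_def)
    moreover have "(\<integral>x. u n x \<partial>\<mu>) = (\<integral>x. \<phi> x \<partial>\<mu>) + \<epsilon> n * \<Delta>"
      unfolding u_def \<Delta>_def using integrable_phi_mu h_mu by (simp add: algebra_simps)
    ultimately have "\<epsilon> n * \<Delta> \<le> (\<integral>y. r n y \<partial>\<nu>) - (\<integral>y. q y \<partial>\<nu>)" by linarith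
    moreover have "(\<integral>y. d n y \<partial>\<nu>) = ((\<integral>y. r n y \<partial>\<nu>) - (\<integral>y. q y \<partial>\<nu>)) / \<epsilon> n"
      unfolding d_def using r_int integrable_q by simp
    ultimately show ?thesis using \<epsilon>[of n] by (simp add: pos_le_divide_eq mult.commute)
  qed
  \<comment> \<open>Envelope principle: the derivative of the perturbed supremum is the perturbation
    evaluated at the unperturbed maximizer \<open>T y\<close>.\<close>
  have d_lim: "(\<lambda>n. d n y) \<longlonglongrightarrow> h (T y) - \<phi> (T y)" if y: "y \<in> smooth" for y
  proof -
    define D where "D x = h x - \<phi> x" for x
    define v where "v = T y"
    have v: "maximizer v y" unfolding v_def by (rule smooth_grad[OF y])
    have yS: "y \<in> S" using v by (simp add: maximizer_def)
    have u_eq: "u n x - norm (x - y) ^ 2 = q y + \<epsilon> n * D x - 2 * gap x y" for n x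
      unfolding cost_eq u_def D_def by (simp add: algebra_simps)
    have lo: "D v \<le> d n y" for n
      using r_ge[OF yS, of n v] \<epsilon>[of n] unfolding d_def u_eq gap_maximizer[OF v] by (simp add: field_simps)
    \<comment> \<open>Near-maximizers with slack \<open>\<epsilon> n ^ 2\<close> suffice, since the
      slack still vanishes after division by \<open>\<epsilon> n\<close>.\<close>
    have "\<exists>x. r n y - \<epsilon> n ^ 2 < u n x - norm (x - y) ^ 2" for n
    proof (rule ccontr)
      assume "\<not> ?thesis"
      then have "Qbar2 (u n) y \<le> ereal (r n y - \<epsilon> n ^ 2)" by (intro Qbar2_le) (auto simp: not_less)
      then show False using \<epsilon>[of n] by (simp add: Q_u[OF yS])
    qed
    then obtain x where x: "\<And>n. r n y - \<epsilon> n ^ 2 < u n (x n) - norm (x n - y) ^ 2" by metis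
    have g0: "0 \<le> gap (x n) y" for n by (rule gap_nonneg[OF yS])
    have key: "\<epsilon> n * d n y + 2 * gap (x n) y \<le> \<epsilon> n * (\<epsilon> n + D (x n))" for n
    proof -
      have "\<epsilon> n * d n y = r n y - q y" using \<epsilon>[of n] by (simp add: d_def)
      then show ?thesis using x[of n] unfolding u_eq by (simp add: algebra_simps power2_eq_square)
    qed
    \<comment> \<open>\<open>hk\<close> bounds \<open>D (x n)\<close> by twice the gap plus a
      quantity free of \<open>n\<close>. As \<open>\<epsilon> n\<close> is at most 1/2, the gap term
      moves to the left side and a bound of order \<open>\<epsilon> n\<close> remains.\<close>
    have gap_le: "gap (x n) y \<le> \<epsilon> n * (1 + \<bar>k y - q y - D v\<bar>)" for n
    proof -
      have "D (x n) \<le> k y - q y + 2 * gap (x n) y"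
        using hk[of "x n" y] cost_eq[of "x n" y] unfolding D_def by linarith
      then have "\<epsilon> n * (\<epsilon> n + D (x n)) \<le> \<epsilon> n * (\<epsilon> n + (k y - q y + 2 * gap (x n) y))"
        using \<epsilon>[of n] by (intro mult_left_mono) auto
      moreover have "\<epsilon> n * D v \<le> \<epsilon> n * d n y" using \<epsilon>[of n] lo[of n] by (intro mult_left_mono) auto
      ultimately have "\<epsilon> n * D v + 2 * gap (x n) y \<le> \<epsilon> n * (\<epsilon> n + (k y - q y + 2 * gap (x n) y))"
        using key[of n] by linarith
      then have "2 * gap (x n) y - \<epsilon> n * (2 * gap (x n) y) \<le> \<epsilon> n * (\<epsilon> n + (k y - q y - D v))"
        by (simp add: algebra_simps)
      moreover have "\<epsilon> n * (2 * gap (x n) y) \<le> 1 / 2 * (2 * gap (x n) y)"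
        using \<epsilon>[of n] g0[of n] by (intro mult_right_mono) auto
      moreover have "\<epsilon> n * (\<epsilon> n + (k y - q y - D v)) \<le> \<epsilon> n * (1 + \<bar>k y - q y - D v\<bar>)"
        using \<epsilon>[of n] by (intro mult_left_mono add_mono) auto
      ultimately show ?thesis by linarith
    qed
    have "(\<lambda>n. gap (x n) y) \<longlonglongrightarrow> 0"
      by (rule real_tendsto_sandwich[OF _ _ tendsto_const tendsto_mult_left_zero[OF \<epsilon>_lim, of "1 + \<bar>k y - q y - D v\<bar>"]])
         (use g0 gap_le in auto)
    then have "x \<longlonglongrightarrow> v"
      by (intro smooth_tendsto[OF y v]) (simp add: gap_def)
    moreover have "isCont D v"
      using cont_h continuous_phi unfolding D_def continuous_on_eq_continuous_at[OF open_UNIV]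
      by (intro continuous_intros) auto
    ultimately have "(\<lambda>n. D (x n)) \<longlonglongrightarrow> D v" by (rule isCont_tendsto_compose[rotated])
    from tendsto_add[OF \<epsilon>_lim this] have up_lim: "(\<lambda>n. \<epsilon> n + D (x n)) \<longlonglongrightarrow> D v" by simp
    have up: "d n y \<le> \<epsilon> n + D (x n)" for n
    proof -
      have "\<epsilon> n * d n y \<le> \<epsilon> n * (\<epsilon> n + D (x n))" using key[of n] g0[of n] by linarith
      then show ?thesis using \<epsilon>[of n] by simp
    qed
    have "(\<lambda>n. d n y) \<longlonglongrightarrow> D v"
      by (rule real_tendsto_sandwich[OF _ _ tendsto_const up_lim]) (use lo up in auto)
    then show ?thesis by (simp add: D_def v_def)
  qed
  \<comment> \<open>The quotients have an integrable upper bound, hence Fatou's lemma is applied to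
    \<open>- d n\<close>.\<close>
  have d_le: "q y - k y \<le> - d n y" if "y \<in> S" for n y
  proof -
    have "r n y - q y \<le> (k y - q y) * \<epsilon> n" using r_le[OF that, of n] by (simp add: algebra_simps)
    then have "d n y \<le> k y - q y" unfolding d_def pos_divide_le_eq[OF \<epsilon>(1)] .
    then show ?thesis by simp
  qed
  have int: "integrable \<nu> (\<lambda>y. - d n y)" for n unfolding d_def using r_int integrable_q by simp
  have low: "integrable \<nu> (\<lambda>y. q y - k y)" using k integrable_q by simp
  have low_le: "AE y in \<nu>. q y - k y \<le> - d n y" for n
    using AE_S by eventually_elim (rule d_le)
  have K: "(\<integral>y. - d n y \<partial>\<nu>) \<le> - \<Delta>" for n using d_ge[of n] by simp
  have lim: "AE y in \<nu>. (\<lambda>n. - d n y) \<longlonglongrightarrow> - (h (T y) - \<phi> (T y))"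
    using AE_smooth_nu by eventually_elim (intro tendsto_minus d_lim)
  have meas: "(\<lambda>y. - (h (T y) - \<phi> (T y))) \<in> borel_measurable \<nu>" by measurable
  note F = integral_fatou[OF int low low_le K lim meas]
  from integrable_minus[OF F(1)] show *: "integrable \<nu> (\<lambda>y. h (T y) - \<phi> (T y))" by simp
  show "(\<integral>x. h x \<partial>\<mu>) - (\<integral>x. \<phi> x \<partial>\<mu>) \<le> (\<integral>y. h (T y) - \<phi> (T y) \<partial>\<nu>)"
    using F(2) unfolding \<Delta>_def Bochner_Integration.integral_minus by linarith
qed

end

section \<open>Lipschitz test functions and closeness of measures\<close>

text \<open>A point \<open>z\<close> is paired with the point \<open>w\<close> of the unit sphere on
  the opposite side of \<open>x\<close>; convexity along that segment and boundedness of
  \<open>h\<close> on the sphere bound \<open>h z\<close> from below.\<close>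

lemma convex_on_linear_lower_bound:
  fixes h :: "'a::euclidean_space \<Rightarrow> real"
  assumes h: "convex_on UNIV h"
  obtains M where "0 \<le> M" "\<And>z. h x - M * norm (z - x) \<le> h z"
proof -
  have "continuous_on UNIV h" using h by (intro convex_on_continuous) auto
  then have "compact (h ` sphere x 1)"
    by (intro compact_continuous_image) (auto intro: continuous_on_subset)
  then obtain B where B: "\<And>w. dist x w = 1 \<Longrightarrow> \<bar>h w\<bar> \<le> B"
    using compact_imp_bounded by (fastforce simp: bounded_iff)
  define M where "M = \<bar>B\<bar> + \<bar>h x\<bar>"
  have "h x - M * norm (z - x) \<le> h z" for z
  proof (cases "z = x")
    case False
    define s where "s = norm (z - x)"
    define w where "w = x - (1 / s) *\<^sub>R (z - x)"
    have s: "s > 0" using False by (simp add: s_def)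
    have "dist x w = 1" using s by (simp add: w_def dist_norm s_def[symmetric])
    then have hw: "h w \<le> \<bar>B\<bar>" using B[of w] by linarith
    \<comment> \<open>The weights are dictated by the distances \<open>s\<close> and 1 from
      \<open>x\<close> to \<open>z\<close> and \<open>w\<close>.\<close>
    have "x = (1 / (1 + s)) *\<^sub>R z + (s / (1 + s)) *\<^sub>R w"
    proof -
      have "(1 + s) *\<^sub>R x = z + s *\<^sub>R w" using s by (simp add: w_def algebra_simps)
      then have "(1 / (1 + s)) *\<^sub>R ((1 + s) *\<^sub>R x) = (1 / (1 + s)) *\<^sub>R (z + s *\<^sub>R w)" by simp
      then show ?thesis using s by (simp add: scaleR_add_right)
    qed
    then have "h x \<le> 1 / (1 + s) * h z + s / (1 + s) * h w"
      using h s unfolding convex_on_def by (metis UNIV_I add_divide_distrib add_nonneg_nonneg divide_nonneg_nonneg divide_self less_eq_real_def less_numeral_extra(1) add_pos_pos order_less_irrefl)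
    then have "(1 + s) * h x \<le> (1 + s) * (1 / (1 + s) * h z + s / (1 + s) * h w)"
      using s by (intro mult_left_mono) auto
    also have "\<dots> = h z + s * h w"
      using s by (simp only: distrib_left mult.assoc[symmetric]) simp
    also have "\<dots> \<le> h z + s * \<bar>B\<bar>" using s hw by (intro add_left_mono mult_left_mono) auto
    finally have "h x + s * h x \<le> h z + s * \<bar>B\<bar>" by (simp add: algebra_simps)
    moreover have "- (s * \<bar>h x\<bar>) \<le> s * h x"
      using mult_left_mono[of "- \<bar>h x\<bar>" "h x" s] s by simp
    ultimately show ?thesis unfolding M_def s_def[symmetric] by (simp add: algebra_simps)
  qed simp
  then show ?thesis by (intro that[of M]) (auto simp: M_def)
qed

text \<open>Pasch--Hausdorff regularization: the infimal convolution with \<open>L * norm\<close> is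
  \<open>L\<close>-Lipschitz, and by convexity it agrees with \<open>h\<close> at a given point once \<open>L\<close> is large.\<close>

lemma convex_on_lipschitz_approximation:
  fixes h :: "'a::euclidean_space \<Rightarrow> real"
  assumes h: "convex_on UNIV h"
  obtains u L c M where "\<And>n. convex_on UNIV (u n)" "\<And>n::nat. 0 \<le> L n"
    "\<And>n x y. \<bar>u n x - u n y\<bar> \<le> L n * norm (x - y)"
    "\<And>n x. c - M * norm x \<le> u n x" "\<And>n x. u n x \<le> h x" "\<And>x. (\<lambda>n. u n x) \<longlonglongrightarrow> h x"
proof -
  obtain M where M: "0 \<le> M" "\<And>z. h 0 - M * norm (z - 0) \<le> h z"
    using convex_on_linear_lower_bound[OF h] by blast
  \<comment> \<open>Slopes of at least \<open>M\<close> keep the infimum below finite.\<close>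
  define L where "L n = real n + M" for n
  define u where "u n x = (INF z. h z + L n * norm (x - z))" for n x
  have L: "0 \<le> L n" "M \<le> L n" for n using M by (auto simp: L_def)
  have lower: "h 0 - M * norm x \<le> h z + L n * norm (x - z)" for n x z
  proof -
    have "M * norm z \<le> M * (norm x + norm (x - z))"
      using M norm_triangle_ineq4[of x "x - z"] by (intro mult_left_mono) auto
    moreover have "M * norm (x - z) \<le> L n * norm (x - z)" using L by (intro mult_right_mono) auto
    ultimately show ?thesis using M(2)[of z] by (simp add: algebra_simps)
  qed
  have bdd: "bdd_below (range (\<lambda>z. h z + L n * norm (x - z)))" for n x
    using lower by (intro bdd_belowI2)
  have u_le: "u n x \<le> h z + L n * norm (x - z)" for n x z
    unfolding u_def by (rule cINF_lower[OF bdd]) simp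
  have u_ge: "a \<le> u n x" if "\<And>z. a \<le> h z + L n * norm (x - z)" for a n x
    unfolding u_def using that by (intro cINF_greatest) auto
  have u_approx: "\<exists>z. h z + L n * norm (x - z) < u n x + e" if "e > 0" for n x e
    using u_ge[of "u n x + e" n x] that by (force simp: not_less)
  show ?thesis
  proof (rule that[of u L "h 0" M])
    show "convex_on UNIV (u n)" for n
    proof (rule convex_onI)
      fix t :: real and x y assume t: "0 < t" "t < 1"
      show "u n ((1 - t) *\<^sub>R x + t *\<^sub>R y) \<le> (1 - t) * u n x + t * u n y"
      proof (rule field_le_epsilon)
        fix e :: real assume e: "e > 0"
        obtain z w where z: "h z + L n * norm (x - z) < u n x + e" and w: "h w + L n * norm (y - w) < u n y + e"
          using u_approx[OF e] by metis
        \<comment> \<open>The combination of near-minimizers for \<open>x\<close> and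
          \<open>y\<close> is a test point for the infimum at the combination of \<open>x\<close>
          and \<open>y\<close>.\<close>
        let ?v = "(1 - t) *\<^sub>R z + t *\<^sub>R w"
        have "norm ((1 - t) *\<^sub>R x + t *\<^sub>R y - ?v) = norm ((1 - t) *\<^sub>R (x - z) + t *\<^sub>R (y - w))"
          by (simp add: algebra_simps)
        also have "\<dots> \<le> (1 - t) * norm (x - z) + t * norm (y - w)"
          using t by (intro order_trans[OF norm_triangle_ineq]) auto
        finally have "L n * norm ((1 - t) *\<^sub>R x + t *\<^sub>R y - ?v) \<le> L n * ((1 - t) * norm (x - z) + t * norm (y - w))"
          using L by (intro mult_left_mono) auto
        moreover have "h ?v \<le> (1 - t) * h z + t * h w"
          using convex_onD[OF h, of t z w] t by auto
        ultimately have "u n ((1 - t) *\<^sub>R x + t *\<^sub>R y)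
            \<le> (1 - t) * (h z + L n * norm (x - z)) + t * (h w + L n * norm (y - w))"
          using u_le[of n "(1 - t) *\<^sub>R x + t *\<^sub>R y" ?v] by (simp add: algebra_simps)
        also have "\<dots> \<le> (1 - t) * (u n x + e) + t * (u n y + e)"
          using mult_left_mono[OF less_imp_le[OF z], of "1 - t"] mult_left_mono[OF less_imp_le[OF w], of t] t
          by (intro add_mono) auto
        finally show "u n ((1 - t) *\<^sub>R x + t *\<^sub>R y) \<le> (1 - t) * u n x + t * u n y + e"
          by (simp add: algebra_simps)
      qed
    qed simp
    have lip: "u n x - u n y \<le> L n * norm (x - y)" for n x y
    proof -
      have "u n x - L n * norm (x - y) \<le> u n y"
      proof (rule u_ge)
        fix z
        have "L n * norm (x - z) \<le> L n * (norm (x - y) + norm (y - z))"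
          using L norm_triangle_ineq[of "x - y" "y - z"] by (intro mult_left_mono) auto
        then show "u n x - L n * norm (x - y) \<le> h z + L n * norm (y - z)"
          using u_le[of n x z] by (simp add: algebra_simps)
      qed
      then show ?thesis by simp
    qed
    show "\<bar>u n x - u n y\<bar> \<le> L n * norm (x - y)" for n x y
      using lip[of n x y] lip[of n y x] by (simp add: norm_minus_commute abs_le_iff)
    show "h 0 - M * norm x \<le> u n x" for n x by (rule u_ge[OF lower])
    show le: "u n x \<le> h x" for n x using u_le[of n x x] by simp
    show "(\<lambda>n. u n x) \<longlonglongrightarrow> h x" for x
    proof (rule tendsto_eventually)
      obtain K where K: "0 \<le> K" "\<And>z. h x - K * norm (z - x) \<le> h z"
        using convex_on_linear_lower_bound[OF h] by blast
      obtain N where N: "K \<le> real N" using real_arch_simple by blast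
      have "u n x = h x" if "n \<ge> N" for n
      proof (rule antisym[OF le u_ge])
        fix z
        have "K * norm (z - x) \<le> L n * norm (z - x)"
          using N that M by (intro mult_right_mono) (auto simp: L_def)
        then show "h x \<le> h z + L n * norm (x - z)" using K(2)[of z] by (simp add: norm_minus_commute)
      qed
      then show "\<forall>\<^sub>F n in sequentially. u n x = h x" by (auto simp: eventually_sequentially)
    qed
  qed (use L in auto)
qed

lemma linear_growth_imp_quadratic:
  fixes x :: "'a::real_normed_vector"
  assumes "\<bar>a\<bar> \<le> b + c * norm x" "0 \<le> b" "0 \<le> c"
  shows "\<bar>a\<bar> \<le> (b + c) * (1 + norm x ^ 2)"
proof -
  have "0 \<le> (norm x - 1 / 2) ^ 2" by simp
  then have "norm x \<le> 1 + norm x ^ 2" by (simp add: power2_eq_square algebra_simps)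
  then have "c * norm x \<le> c * (1 + norm x ^ 2)" using assms by (intro mult_left_mono) auto
  moreover have "b * 1 \<le> b * (1 + norm x ^ 2)" using assms by (intro mult_left_mono) auto
  ultimately show ?thesis using assms(1) by (simp add: distrib_right)
qed

lemma lipschitz_growth:
  fixes u :: "'a::real_normed_vector \<Rightarrow> real"
  assumes "0 \<le> L" "\<And>x y. \<bar>u x - u y\<bar> \<le> L * norm (x - y)"
  shows "\<bar>u x\<bar> \<le> (\<bar>u 0\<bar> + L) * (1 + norm x ^ 2)"
  using assms(2)[of x 0] by (intro linear_growth_imp_quadratic assms(1)) auto

lemma eint_exists_real:
  assumes "integrable M u"
  shows "eint_exists M (\<lambda>x. ereal (u x))"
  using assms by (auto simp: eint_exists_def eint_pos_def eint_neg_def real_integrable_def)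

lemma eint_real: "integrable M u \<Longrightarrow> eint M (\<lambda>x. ereal (u x)) = ereal (\<integral>x. u x \<partial>M)"
  by (rule eint_eq_integral) auto

text \<open>Lipschitz convex minorants of \<open>h\<close> are integrable under both measures. Their
  integrals under \<open>\<xi>\<close> stay below that of \<open>h\<close>, and Fatou's lemma passes
  to the limit under \<open>\<mu>\<close>.\<close>

lemma cx_le_if_lipschitz:
  fixes \<mu> \<xi> :: "'a::euclidean_space measure"
  assumes mu: "\<mu> \<in> P2" and xi: "\<xi> \<in> P2"
    and le: "\<And>u L. convex_on UNIV u \<Longrightarrow> 0 \<le> L \<Longrightarrow> (\<And>x y. \<bar>u x - u y\<bar> \<le> L * norm (x - y)) \<Longrightarrow>
      (\<integral>x. u x \<partial>\<mu>) \<le> (\<integral>x. u x \<partial>\<xi>)"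
  shows "cx_le \<mu> \<xi>"
  unfolding cx_le_def
proof (intro allI impI)
  fix h :: "'a \<Rightarrow> real" assume h: "convex_on UNIV h"
  have cont: "continuous_on UNIV v" if "convex_on UNIV v" for v :: "'a \<Rightarrow> real"
    using that by (intro convex_on_continuous) auto
  have [measurable]: "h \<in> borel_measurable borel" using cont[OF h] by (rule borel_measurable_continuous_onI)
  have [measurable_cong]: "sets \<mu> = sets borel" "sets \<xi> = sets borel" using mu xi by (auto simp: P2_def)
  show "eint \<mu> (\<lambda>x. ereal (h x)) \<le> eint \<xi> (\<lambda>x. ereal (h x))"
  proof (cases "eint \<xi> (\<lambda>x. ereal (h x)) = \<infinity>")
    \<comment> \<open>An infinite right side is trivial; otherwise the minorant linear in
      \<open>norm x\<close> makes \<open>h\<close> integrable under \<open>\<xi>\<close>.\<close>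
    case False
    obtain u L c M where u: "\<And>n. convex_on UNIV (u n)" "\<And>n::nat. 0 \<le> L n"
      "\<And>n x y. \<bar>u n x - u n y\<bar> \<le> L n * norm (x - y)" "\<And>n x. c - M * norm x \<le> u n x"
      "\<And>n x. u n x \<le> h x" "\<And>x. (\<lambda>n. u n x) \<longlonglongrightarrow> h x"
      using convex_on_lipschitz_approximation[OF h] by blast
    have u_int: "integrable \<mu> (u n)" "integrable \<xi> (u n)" for n
      by (rule P2_integrable[OF _ borel_measurable_continuous_onI[OF cont[OF u(1)]] lipschitz_growth[OF u(2,3)]], fact)+
    have "\<bar>c - M * norm x\<bar> \<le> \<bar>c\<bar> + \<bar>M\<bar> * norm x" for x :: 'a
      using abs_triangle_ineq4[of c "M * norm x"] by (simp add: abs_mult)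
    then have lin_bound: "\<bar>c - M * norm x\<bar> \<le> (\<bar>c\<bar> + \<bar>M\<bar>) * (1 + norm x ^ 2)" for x :: 'a
      by (rule linear_growth_imp_quadratic) auto
    have l_int: "integrable \<mu> (\<lambda>x. c - M * norm x)" "integrable \<xi> (\<lambda>x. c - M * norm x)"
      by (rule P2_integrable[OF _ _ lin_bound]; simp add: mu xi)+
    have lh: "c - M * norm x \<le> h x" for x by (rule order_trans[OF u(4) u(5)])
    have "integrable \<xi> (\<lambda>x. real_of_ereal (ereal (h x)))"
      by (rule eint_finite_imp_integrable(1)[OF _ l_int(2) _ False]) (use lh in auto)
    then have h_xi: "integrable \<xi> h" by simp
    have K: "(\<integral>x. u n x \<partial>\<mu>) \<le> (\<integral>x. h x \<partial>\<xi>)" for n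
      using le[OF u(1)[of n] u(2)[of n] u(3)[of n]] integral_mono[OF u_int(2)[of n] h_xi u(5)[of n]] by linarith
    have low: "AE x in \<mu>. c - M * norm x \<le> u n x" for n using u(4) by simp
    have lim: "AE x in \<mu>. (\<lambda>n. u n x) \<longlonglongrightarrow> h x" using u(6) by simp
    have "h \<in> borel_measurable \<mu>" by measurable
    note integral_fatou[OF u_int(1) l_int(1) low K lim this]
    then show ?thesis using h_xi by (simp add: eint_real)
  qed simp
qed

section \<open>Comparing laws through random variables close in probability\<close>

text \<open>Outside an event of small probability, \<open>X\<close> in \<open>F\<close> puts
  \<open>Y\<close> into a closed neighbourhood of \<open>F\<close>. First \<open>d\<close> and then
  \<open>e\<close> tends to 0.\<close>

lemma closed_measure_le_if_close:
  fixes \<xi> \<xi>' :: "'a::euclidean_space measure"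
  assumes close: "\<And>e d. 0 < e \<Longrightarrow> 0 < d \<Longrightarrow> \<exists>(M :: 'b measure) X Y. prob_space M \<and>
      X \<in> borel_measurable M \<and> Y \<in> borel_measurable M \<and> distr M borel X = \<xi> \<and> distr M borel Y = \<xi>' \<and>
      measure M {p \<in> space M. e < dist (X p) (Y p)} \<le> d"
    and F: "closed F"
  shows "measure \<xi> F \<le> measure \<xi>' F"
proof (cases "F = {}")
  \<comment> \<open>\<open>infdist\<close> to the empty set is 0 by convention, so the
    neighbourhoods \<open>G e\<close> shrink to \<open>F\<close> only for nonempty
    \<open>F\<close>.\<close>
  case False
  define G where "G e = {z. infdist z F \<le> e}" for e
  have Gc: "closed (G e)" for e
    unfolding G_def by (intro closed_Collect_le continuous_intros)
  have step: "measure \<xi> F \<le> measure \<xi>' (G e)" if "e > 0" for e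
  proof (rule field_le_epsilon)
    fix d :: real assume "d > 0"
    with \<open>e > 0\<close> obtain M :: "'b measure" and X Y where M: "prob_space M"
      and [measurable]: "X \<in> borel_measurable M" "Y \<in> borel_measurable M"
      and XY: "distr M borel X = \<xi>" "distr M borel Y = \<xi>'"
      and small: "measure M {p \<in> space M. e < dist (X p) (Y p)} \<le> d"
      using close by blast
    interpret prob_space M by fact
    have [measurable]: "F \<in> sets borel" "G e \<in> sets borel" using F Gc by auto
    have "measure \<xi> F = measure M {p \<in> space M. X p \<in> F}"
      unfolding XY(1)[symmetric] by (subst measure_distr) (auto intro!: arg_cong[where f = "measure M"])
    also have "\<dots> \<le> measure M ({p \<in> space M. Y p \<in> G e} \<union> {p \<in> space M. e < dist (X p) (Y p)})"
    proof (rule finite_measure_mono)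
      have "infdist (Y p) F \<le> dist (X p) (Y p)" if "X p \<in> F" for p
        using infdist_le[OF that, of "Y p"] by (simp add: dist_commute)
      then show "{p \<in> space M. X p \<in> F} \<subseteq> {p \<in> space M. Y p \<in> G e} \<union> {p \<in> space M. e < dist (X p) (Y p)}"
        by (force simp: G_def)
    qed measurable
    also have "\<dots> \<le> measure M {p \<in> space M. Y p \<in> G e} + measure M {p \<in> space M. e < dist (X p) (Y p)}"
      by (rule measure_Un_le) measurable
    also have "measure M {p \<in> space M. Y p \<in> G e} = measure \<xi>' (G e)"
      unfolding XY(2)[symmetric] by (subst measure_distr) (auto intro!: arg_cong[where f = "measure M"])
    finally show "measure \<xi> F \<le> measure \<xi>' (G e) + d" using small by linarith
  qed
  \<comment> \<open>A single instance already shows that \<open>\<xi>'\<close> is a probability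
    measure; its finiteness gives continuity from above.\<close>
  obtain M :: "'b measure" and Y where M: "prob_space M" "Y \<in> borel_measurable M" "distr M borel Y = \<xi>'"
    using close[of 1 1] by auto
  interpret \<xi>': prob_space \<xi>' using prob_space.prob_space_distr[OF M(1,2)] M(3) by simp
  have sets: "sets \<xi>' = sets borel" using M(3) by auto
  have "(\<lambda>n. measure \<xi>' (G (inverse (real (Suc n))))) \<longlonglongrightarrow> measure \<xi>' (\<Inter>n. G (inverse (real (Suc n))))"
  proof (rule \<xi>'.finite_Lim_measure_decseq)
    show "range (\<lambda>n. G (inverse (real (Suc n)))) \<subseteq> sets \<xi>'" using Gc sets by auto
    show "decseq (\<lambda>n. G (inverse (real (Suc n))))"
    proof (rule decseq_SucI)
      fix n
      have "inverse (real (Suc (Suc n))) \<le> inverse (real (Suc n))" by (intro le_imp_inverse_le) auto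
      then have "infdist z F \<le> inverse (real (Suc n))" if "infdist z F \<le> inverse (real (Suc (Suc n)))" for z
        using that by linarith
      then show "G (inverse (real (Suc (Suc n)))) \<subseteq> G (inverse (real (Suc n)))"
        unfolding G_def by blast
    qed
  qed
  moreover have "(\<Inter>n. G (inverse (real (Suc n)))) = F"
  proof -
    have "infdist z F \<le> 0" if "z \<in> (\<Inter>n. G (inverse (real (Suc n))))" for z
    proof (rule ccontr)
      assume "\<not> infdist z F \<le> 0"
      then obtain n where "inverse (real (Suc n)) < infdist z F" using reals_Archimedean[of "infdist z F"] by auto
      moreover have "infdist z F \<le> inverse (real (Suc n))" using that unfolding G_def by blast
      ultimately show False by linarith
    qed
    then have "z \<in> F" if "z \<in> (\<Inter>n. G (inverse (real (Suc n))))" for z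
      using that in_closed_iff_infdist_zero[OF F False] infdist_nonneg[of z F] by (meson order_antisym)
    moreover have "z \<in> G (inverse (real (Suc n)))" if "z \<in> F" for z n
      using that by (simp add: G_def del: of_nat_Suc)
    ultimately show ?thesis by blast
  qed
  ultimately show ?thesis
    by (intro LIMSEQ_le_const[of _ "measure \<xi>' F"]) (use step in \<open>auto simp del: of_nat_Suc\<close>)
qed simp

text \<open>Closed sets form an intersection-stable generator of the Borel sigma-algebra.\<close>

lemma measure_eq_if_closed_eq:
  fixes \<xi> \<xi>' :: "'a::euclidean_space measure"
  assumes "prob_space \<xi>" "prob_space \<xi>'" "sets \<xi> = sets borel" "sets \<xi>' = sets borel"
    and eq: "\<And>F. closed F \<Longrightarrow> measure \<xi> F = measure \<xi>' F"
  shows "\<xi> = \<xi>'"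
proof (rule measure_eqI_generator_eq[where E = "Collect closed" and \<Omega> = UNIV and A = "\<lambda>_. UNIV"])
  interpret \<xi>: prob_space \<xi> by fact
  interpret \<xi>': prob_space \<xi>' by fact
  show "Int_stable (Collect closed :: 'a set set)" by (auto simp: Int_stable_def)
  show "emeasure \<xi> F = emeasure \<xi>' F" if "F \<in> Collect closed" for F
    using eq[of F] that by (simp add: \<xi>.emeasure_eq_measure \<xi>'.emeasure_eq_measure)
  show "sets \<xi> = sigma_sets UNIV (Collect closed)" "sets \<xi>' = sigma_sets UNIV (Collect closed)"
    using assms(3,4) by (auto simp: borel_eq_closed)
  show "emeasure \<xi> UNIV \<noteq> \<infinity>" by simp
qed auto

section \<open>The optimal transport problem\<close>

context dual_optimizer
begin

section \<open>Feasibility of the pushforward under the gradient\<close>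

definition "\<xi>0 = distr \<nu> borel T"
text \<open>The optimal dual value by \<open>dual_value\<close>; it turns out to be the minimal
  transport cost.\<close>

definition "V = (\<integral>x. \<phi> x \<partial>\<mu>) - (\<integral>y. q y \<partial>\<nu>)"

lemma integrable_phi_T: "integrable \<nu> (\<lambda>y. \<phi> (T y))"
  and integral_phi_T_le: "(\<integral>y. \<phi> (T y) \<partial>\<nu>) \<le> (\<integral>x. \<phi> x \<partial>\<mu>)"
proof -
  have "integrable \<nu> (\<lambda>y. 0 - \<phi> (T y))"
    and le: "(\<integral>x. 0 \<partial>\<mu>) - (\<integral>x. \<phi> x \<partial>\<mu>) \<le> (\<integral>y. 0 - \<phi> (T y) \<partial>\<nu>)"
    by (rule variation[where h = "\<lambda>_. 0" and K = 0 and k = "\<lambda>_. 0"]; simp add: convex_on_const)+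
  from integrable_minus[OF this(1)] show "integrable \<nu> (\<lambda>y. \<phi> (T y))" by simp
  show "(\<integral>y. \<phi> (T y) \<partial>\<nu>) \<le> (\<integral>x. \<phi> x \<partial>\<mu>)" using le by simp
qed

lemma AE_cost_T: "AE y in \<nu>. norm (T y - y) ^ 2 = \<phi> (T y) - q y"
  using AE_maximizer by eventually_elim (simp add: cost_eq gap_maximizer)

text \<open>Almost everywhere the squared displacement equals the integrable function
  \<open>\<phi> (T y) - q y\<close>; adding \<open>y\<close> back costs a factor 2.\<close>

lemma integrable_T_sq: "integrable \<nu> (\<lambda>y. norm (T y) ^ 2)"
proof (rule Bochner_Integration.integrable_bound)
  show "integrable \<nu> (\<lambda>y. 2 * (\<phi> (T y) - q y) + 2 * norm y ^ 2)"
    using integrable_phi_T integrable_q P2_integrable_norm_sq[OF nu] by simp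
  show "AE y in \<nu>. norm (norm (T y) ^ 2) \<le> norm (2 * (\<phi> (T y) - q y) + 2 * norm y ^ 2)"
    using AE_cost_T
  proof eventually_elim
    case (elim y)
    have "norm (T y) ^ 2 \<le> 2 * (\<phi> (T y) - q y) + 2 * norm y ^ 2"
      using norm_diff_sq_le[of "T y - y" "- y"] elim by simp
    then show ?case by simp
  qed
qed measurable

lemma sets_xi0 [measurable_cong]: "sets \<xi>0 = sets borel"
  by (simp add: \<xi>0_def)

lemma xi0_P2: "\<xi>0 \<in> P2"
proof -
  have "prob_space \<xi>0" unfolding \<xi>0_def by (rule \<nu>.prob_space_distr) measurable
  moreover have "(\<integral>\<^sup>+ x. ennreal (norm x ^ 2) \<partial>\<xi>0) = (\<integral>\<^sup>+ y. ennreal (norm (T y) ^ 2) \<partial>\<nu>)"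
    unfolding \<xi>0_def by (subst nn_integral_distr) auto
  moreover have "\<dots> < \<infinity>"
    using integrable_T_sq by (simp add: nn_integral_eq_integral)
  ultimately show ?thesis by (simp add: P2_def sets_xi0)
qed

lemma integral_xi0: "u \<in> borel_measurable borel \<Longrightarrow> (\<integral>x. u x \<partial>\<xi>0) = (\<integral>y. u (T y) \<partial>\<nu>)"
  for u :: "'a \<Rightarrow> real"
  unfolding \<xi>0_def by (rule integral_distr) auto

text \<open>The first-order condition for \<open>n * h\<close> bounds \<open>n * \<Delta>\<close> by
  a quantity free of \<open>n\<close>, which excludes a positive \<open>\<Delta>\<close>.\<close>

lemma lipschitz_integral_le:
  assumes h: "convex_on UNIV h" and L: "0 \<le> L" "\<And>x y. \<bar>h x - h y\<bar> \<le> L * norm (x - y)"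
  shows "(\<integral>x. h x \<partial>\<mu>) \<le> (\<integral>x. h x \<partial>\<xi>0)"
proof -
  have h_borel [measurable]: "h \<in> borel_measurable borel"
    using h by (intro borel_measurable_continuous_onI convex_on_continuous) auto
  note growth = lipschitz_growth[OF L]
  have h_int: "integrable \<mu> h" "integrable \<nu> h" "integrable \<xi>0 h"
    by (rule P2_integrable[OF _ h_borel growth]; simp add: mu nu xi0_P2)+
  have hT: "integrable \<nu> (\<lambda>y. h (T y))"
    using h_int(3) unfolding \<xi>0_def by (simp add: integrable_distr_eq)
  define \<Delta> where "\<Delta> = (\<integral>x. h x \<partial>\<mu>) - (\<integral>y. h (T y) \<partial>\<nu>)"
  have bound: "real n * \<Delta> \<le> (\<integral>x. \<phi> x \<partial>\<mu>) - (\<integral>y. \<phi> (T y) \<partial>\<nu>)" for n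
  proof -
    have "(\<integral>x. real n * h x \<partial>\<mu>) - (\<integral>x. \<phi> x \<partial>\<mu>) \<le> (\<integral>y. real n * h (T y) - \<phi> (T y) \<partial>\<nu>)"
    \<comment> \<open>The constant \<open>(real n * L) ^ 2 / 4\<close> is the maximum of
      \<open>real n * L * s - s ^ 2\<close> over distances \<open>s = norm (x - y)\<close>.\<close>
    proof (rule variation(2)[where K = "real n * (\<bar>h 0\<bar> + L)" and k = "\<lambda>y. real n * h y + (real n * L) ^ 2 / 4"])
      show "convex_on UNIV (\<lambda>x. real n * h x)" using h by (intro convex_on_cmul) auto
      show "\<bar>real n * h x\<bar> \<le> real n * (\<bar>h 0\<bar> + L) * (1 + norm x ^ 2)" for x
        using mult_left_mono[OF growth[of x], of "real n"] by (simp add: abs_mult mult.assoc)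
      show "integrable \<nu> (\<lambda>y. real n * h y + (real n * L) ^ 2 / 4)" using h_int(2) by simp
      show "real n * h x - norm (x - y) ^ 2 \<le> real n * h y + (real n * L) ^ 2 / 4" for x y
      proof -
        have "real n * (h x - h y) \<le> real n * (L * norm (x - y))"
          using L(2)[of x y] by (intro mult_left_mono) auto
        moreover have "0 \<le> (norm (x - y) - real n * L / 2) ^ 2" by simp
        moreover have "(norm (x - y) - real n * L / 2) ^ 2 =
            norm (x - y) ^ 2 - real n * (L * norm (x - y)) + (real n * L) ^ 2 / 4"
          by (simp add: power2_diff power_divide)
        ultimately show ?thesis by (simp only: right_diff_distrib)
      qed
    qed
    then show ?thesis using hT integrable_phi_T by (simp add: \<Delta>_def algebra_simps)
  qed
  have "\<Delta> \<le> 0"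
  proof (rule ccontr)
    assume "\<not> \<Delta> \<le> 0"
    then obtain n where "(\<integral>x. \<phi> x \<partial>\<mu>) - (\<integral>y. \<phi> (T y) \<partial>\<nu>) < real n * \<Delta>"
      using reals_Archimedean3[of \<Delta>] by auto
    with bound[of n] show False by simp
  qed
  then show ?thesis by (simp add: \<Delta>_def integral_xi0)
qed

lemma xi0_above: "\<xi>0 \<in> P2cx_above \<mu>"
  using xi0_P2 cx_le_if_lipschitz[OF mu xi0_P2 lipschitz_integral_le] by (simp add: P2cx_above_def)

lemma integral_phi_le:
  assumes "\<xi> \<in> P2cx_above \<mu>"
  shows "(\<integral>x. \<phi> x \<partial>\<mu>) \<le> (\<integral>x. \<phi> x \<partial>\<xi>)"
proof -
  have xi: "\<xi> \<in> P2" "cx_le \<mu> \<xi>" using assms by (auto simp: P2cx_above_def)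
  have int: "integrable \<xi> \<phi>" by (rule P2_integrable[OF xi(1) phi_borel growth_phi])
  have "eint \<mu> (\<lambda>x. ereal (\<phi> x)) \<le> eint \<xi> (\<lambda>x. ereal (\<phi> x))"
    using xi(2) convex_phi eint_exists_real[OF integrable_phi_mu] eint_exists_real[OF int]
    unfolding cx_le_def by blast
  then show ?thesis by (simp add: eint_real int integrable_phi_mu)
qed

section \<open>Couplings, weak duality and attainment\<close>

lemma coupling_measurable:
  assumes "\<pi> \<in> couplings \<xi> \<nu>"
  shows "sets \<pi> = sets (borel \<Otimes>\<^sub>M borel)" "fst \<in> borel_measurable \<pi>" "snd \<in> borel_measurable \<pi>"
    "distr \<pi> borel fst = \<xi>" "distr \<pi> borel snd = \<nu>" "prob_space \<pi>"
proof -
  show s [measurable_cong]: "sets \<pi> = sets (borel \<Otimes>\<^sub>M borel)" and d: "distr \<pi> borel fst = \<xi>" "distr \<pi> borel snd = \<nu>"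
    using assms by (auto simp: couplings_def)
  show "fst \<in> borel_measurable \<pi>" "snd \<in> borel_measurable \<pi>" by measurable
  then show "prob_space \<pi>"
    using prob_space_distrD[of snd \<pi> borel] d(2) \<nu>.prob_space_axioms by simp
qed

text \<open>The terms in \<open>\<phi>\<close> and \<open>q\<close> depend on the marginals only, so
  among couplings with the same marginals the cost varies only through the mean gap.\<close>

lemma coupling_cost:
  assumes pi: "\<pi> \<in> couplings \<xi> \<nu>" and xi: "\<xi> \<in> P2"
  shows "integrable \<pi> (\<lambda>p. gap (fst p) (snd p))"
    and "0 \<le> (\<integral>p. gap (fst p) (snd p) \<partial>\<pi>)"
    and "(\<integral>\<^sup>+ p. ennreal (norm (fst p - snd p) ^ 2) \<partial>\<pi>) =
      ennreal ((\<integral>x. \<phi> x \<partial>\<xi>) - (\<integral>y. q y \<partial>\<nu>) + 2 * (\<integral>p. gap (fst p) (snd p) \<partial>\<pi>))"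
proof -
  note [measurable] = coupling_measurable(2,3)[OF pi]
  note d = coupling_measurable(4,5)[OF pi]
  have int_fst: "integrable \<pi> (\<lambda>p. u (fst p))" if "u \<in> borel_measurable borel" "integrable \<xi> u" for u :: "'a \<Rightarrow> real"
    using that unfolding d(1)[symmetric] by (subst (asm) integrable_distr_eq) auto
  have int_snd: "integrable \<pi> (\<lambda>p. u (snd p))" if "u \<in> borel_measurable borel" "integrable \<nu> u" for u :: "'a \<Rightarrow> real"
    using that unfolding d(2)[symmetric] by (subst (asm) integrable_distr_eq) auto
  have cost: "integrable \<pi> (\<lambda>p. norm (fst p - snd p) ^ 2)"
  proof (rule Bochner_Integration.integrable_bound)
    show "integrable \<pi> (\<lambda>p. 2 * norm (fst p) ^ 2 + 2 * norm (snd p) ^ 2)"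
      using int_fst[OF _ P2_integrable_norm_sq[OF xi]] int_snd[OF _ P2_integrable_norm_sq[OF nu]] by simp
    show "AE p in \<pi>. norm (norm (fst p - snd p) ^ 2) \<le> norm (2 * norm (fst p) ^ 2 + 2 * norm (snd p) ^ 2)"
      using norm_diff_sq_le by auto
  qed measurable
  have phi: "integrable \<pi> (\<lambda>p. \<phi> (fst p))"
    by (rule int_fst[OF phi_borel P2_integrable[OF xi phi_borel growth_phi]])
  have q: "integrable \<pi> (\<lambda>p. q (snd p))"
    by (rule int_snd[OF q_borel integrable_q])
  have gap_eq: "gap x y = (norm (x - y) ^ 2 - \<phi> x + q y) / 2" for x y
    unfolding cost_eq by simp
  show gap: "integrable \<pi> (\<lambda>p. gap (fst p) (snd p))"
    unfolding gap_eq using cost phi q by simp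
  have "AE p in \<pi>. snd p \<in> S"
    using AE_S unfolding d(2)[symmetric] by (rule AE_distrD[rotated]) measurable
  then have "AE p in \<pi>. 0 \<le> gap (fst p) (snd p)"
    by eventually_elim (rule gap_nonneg)
  then show "0 \<le> (\<integral>p. gap (fst p) (snd p) \<partial>\<pi>)" by (rule integral_nonneg_AE)
  have "(\<integral>\<^sup>+ p. ennreal (norm (fst p - snd p) ^ 2) \<partial>\<pi>) = ennreal (\<integral>p. norm (fst p - snd p) ^ 2 \<partial>\<pi>)"
    using cost by (intro nn_integral_eq_integral) auto
  also have "(\<integral>p. norm (fst p - snd p) ^ 2 \<partial>\<pi>) =
      (\<integral>p. \<phi> (fst p) \<partial>\<pi>) - (\<integral>p. q (snd p) \<partial>\<pi>) + 2 * (\<integral>p. gap (fst p) (snd p) \<partial>\<pi>)"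
    unfolding cost_eq using phi q gap by simp
  also have "(\<integral>p. \<phi> (fst p) \<partial>\<pi>) = (\<integral>x. \<phi> x \<partial>\<xi>)"
    unfolding d(1)[symmetric] by (subst integral_distr) auto
  also have "(\<integral>p. q (snd p) \<partial>\<pi>) = (\<integral>y. q y \<partial>\<nu>)"
    using integral_distr[of snd \<pi> borel q] d(2) by simp
  finally show "(\<integral>\<^sup>+ p. ennreal (norm (fst p - snd p) ^ 2) \<partial>\<pi>) =
      ennreal ((\<integral>x. \<phi> x \<partial>\<xi>) - (\<integral>y. q y \<partial>\<nu>) + 2 * (\<integral>p. gap (fst p) (snd p) \<partial>\<pi>))" .
qed

text \<open>Weak duality: the mean gap is nonnegative, and \<open>\<phi>\<close> is an admissible
  test function for the convex order.\<close>

lemma T2_ge: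
  assumes "\<xi> \<in> P2cx_above \<mu>"
  shows "ennreal V \<le> T2 \<xi> \<nu>"
  unfolding T2_def
proof (rule INF_greatest)
  fix \<pi> assume pi: "\<pi> \<in> couplings \<xi> \<nu>"
  have xi: "\<xi> \<in> P2" using assms by (simp add: P2cx_above_def)
  show "ennreal V \<le> (\<integral>\<^sup>+ p. ennreal (norm (fst p - snd p) ^ 2) \<partial>\<pi>)"
    unfolding coupling_cost(3)[OF pi xi] V_def
    using integral_phi_le[OF assms] coupling_cost(2)[OF pi xi] by (intro ennreal_leI) linarith
qed

lemma graph_coupling: "distr \<nu> (borel \<Otimes>\<^sub>M borel) (\<lambda>y. (T y, y)) \<in> couplings \<xi>0 \<nu>"
proof -
  have "distr \<nu> borel (\<lambda>x. x) = \<nu>" by (rule distr_id2) (simp add: sets_nu)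
  then show ?thesis
    unfolding couplings_def \<xi>0_def by (simp add: distr_distr comp_def)
qed

text \<open>On the graph of \<open>T\<close> the gap vanishes almost everywhere, so the graph
  coupling costs the integral of \<open>\<phi> (T y) - q y\<close>, which
  \<open>integral_phi_T_le\<close> compares with \<open>V\<close>.\<close>

lemma T2_xi0: "T2 \<xi>0 \<nu> \<le> ennreal V"
proof -
  let ?\<pi> = "distr \<nu> (borel \<Otimes>\<^sub>M borel) (\<lambda>y. (T y, y))"
  have "T2 \<xi>0 \<nu> \<le> (\<integral>\<^sup>+ p. ennreal (norm (fst p - snd p) ^ 2) \<partial>?\<pi>)"
    unfolding T2_def by (rule INF_lower) (rule graph_coupling)
  also have "\<dots> = (\<integral>\<^sup>+ y. ennreal (norm (T y - y) ^ 2) \<partial>\<nu>)"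
    by (subst nn_integral_distr) auto
  also have "\<dots> = (\<integral>\<^sup>+ y. ennreal (\<phi> (T y) - q y) \<partial>\<nu>)"
    using AE_cost_T by (intro nn_integral_cong_AE) auto
  also have "\<dots> = ennreal (\<integral>y. \<phi> (T y) - q y \<partial>\<nu>)"
  proof (rule nn_integral_eq_integral)
    show "integrable \<nu> (\<lambda>y. \<phi> (T y) - q y)" using integrable_phi_T integrable_q by simp
    show "AE y in \<nu>. 0 \<le> \<phi> (T y) - q y"
      using AE_cost_T
    proof eventually_elim
      case (elim y)
      show ?case unfolding elim[symmetric] by (rule zero_le_power2)
    qed
  qed
  also have "\<dots> \<le> ennreal V"
    unfolding V_def using integral_phi_T_le integrable_phi_T integrable_q by (intro ennreal_leI) simp
  finally show ?thesis .
qed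

section \<open>Uniqueness of the minimizer\<close>

definition "sum_second_diff n y = (\<Sum>b\<in>Basis. second_diff b n y)"
definition "bad e n = {y. \<not> ((\<forall>b\<in>Basis. y + b /\<^sub>R real n \<in> S \<and> y - b /\<^sub>R real n \<in> S) \<and> sum_second_diff n y \<le> e)}"

lemma bad_borel [measurable]: "bad e n \<in> sets borel"
proof -
  have [measurable]: "finite (Basis :: 'a set)" by simp
  have "bad e n = - ((\<Inter>b\<in>Basis. {y. y + b /\<^sub>R real n \<in> S \<and> y - b /\<^sub>R real n \<in> S}) \<inter> {y. sum_second_diff n y \<le> e})"
    by (auto simp: bad_def)
  moreover have "(\<Inter>b\<in>Basis. {y. y + b /\<^sub>R real n \<in> S \<and> y - b /\<^sub>R real n \<in> S}) \<in> sets borel"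
  proof (intro sets.finite_INT)
    show "{y. y + b /\<^sub>R real n \<in> S \<and> y - b /\<^sub>R real n \<in> S} \<in> sets borel" for b
      by measurable
  qed auto
  moreover have "{y. sum_second_diff n y \<le> e} \<in> sets borel"
    unfolding sum_second_diff_def by measurable
  ultimately show ?thesis by (simp only: sets.Int borel_comp)
qed

lemma eventually_not_bad:
  assumes y: "y \<in> smooth" and e: "0 < e"
  shows "\<forall>\<^sub>F n in sequentially. y \<notin> bad e n"
proof -
  have "\<forall>\<^sub>F n in sequentially. \<forall>b\<in>Basis. y + b /\<^sub>R real n \<in> S \<and> y - b /\<^sub>R real n \<in> S"
  proof (intro eventually_ball_finite ballI)
    fix b :: 'a assume b: "b \<in> Basis"
    have "y \<in> interior S" using y by (simp add: smooth_def)
    then obtain N where N: "\<And>n. n \<ge> N \<Longrightarrow> y + b /\<^sub>R real n \<in> interior S \<and> y - b /\<^sub>R real n \<in> interior S"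
      using interior_shift[OF _ norm_Basis[OF b]] by blast
    show "\<forall>\<^sub>F n in sequentially. y + b /\<^sub>R real n \<in> S \<and> y - b /\<^sub>R real n \<in> S"
      using N interior_subset by (intro eventually_sequentiallyI[of N]) blast
  qed simp
  moreover have "(\<lambda>n. sum_second_diff n y) \<longlonglongrightarrow> (\<Sum>b\<in>(Basis :: 'a set). 0)"
    unfolding sum_second_diff_def using y by (intro tendsto_sum) (auto simp: smooth_def)
  then have "\<forall>\<^sub>F n in sequentially. sum_second_diff n y < e"
    using order_tendstoD(2)[of "\<lambda>n. sum_second_diff n y" 0] e by simp
  ultimately show ?thesis
    by eventually_elim (auto simp: bad_def)
qed

text \<open>Almost every point eventually leaves these sets; dominated convergence for indicators
  works without monotonicity in \<open>n\<close>.\<close>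

lemma measure_bad_tendsto:
  assumes e: "0 < e"
  shows "(\<lambda>n. measure \<nu> (bad e n)) \<longlonglongrightarrow> 0"
proof -
  have "(\<lambda>n. \<integral>y. indicat_real (bad e n) y \<partial>\<nu>) \<longlonglongrightarrow> (\<integral>y. 0 \<partial>\<nu>)"
  proof (rule integral_dominated_convergence[where w = "\<lambda>_. 1"])
    show "AE y in \<nu>. (\<lambda>n. indicat_real (bad e n) y) \<longlonglongrightarrow> 0"
      using AE_smooth_nu
    proof eventually_elim
      case (elim y)
      show ?case
        by (rule tendsto_eventually) (use eventually_not_bad[OF elim e] in eventually_elim, simp)
    qed
    show "AE y in \<nu>. norm (indicat_real (bad e n) y) \<le> 1" for n
      by (auto simp: indicator_def)
  qed auto
  then show ?thesis by (simp add: sets_nu)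
qed

text \<open>Off the bad set the gap controls the distance to \<open>T y\<close> with a constant that
  does not depend on \<open>y\<close>.\<close>

lemma norm_diff_T_le:
  assumes y: "y \<in> smooth" "y \<notin> bad e n" and n: "n > 0"
  shows "norm (x - T y) \<le> real DIM('a) * real n * gap x y + e"
proof -
  have "norm (x - T y) \<le> (\<Sum>b\<in>Basis. \<bar>(x - T y) \<bullet> b\<bar>)" by (rule norm_le_l1)
  also have "\<dots> \<le> (\<Sum>b\<in>Basis. real n * gap x y + second_diff b n y)"
    unfolding gap_def using y n by (intro sum_mono gap_estimate smooth_grad) (auto simp: bad_def)
  also have "\<dots> = real DIM('a) * real n * gap x y + sum_second_diff n y"
    by (simp add: sum.distrib sum_second_diff_def)
  finally show ?thesis using y(2) by (simp add: bad_def)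
qed

text \<open>Near-optimal couplings suffice, so no compactness of the set of couplings is required.\<close>

lemma near_optimal_concentrates:
  assumes xi: "\<xi> \<in> P2cx_above \<mu>" and T2: "T2 \<xi> \<nu> \<le> ennreal V" and e: "0 < e" and \<delta>: "0 < \<delta>"
  obtains \<pi> where "\<pi> \<in> couplings \<xi> \<nu>"
    "measure \<pi> {p \<in> space \<pi>. e < dist (fst p) (T (snd p))} \<le> \<delta>"
proof -
  have xi2: "\<xi> \<in> P2" using xi by (simp add: P2cx_above_def)
  \<comment> \<open>Half of \<open>\<delta>\<close> is reserved for the bad set and half for
    Markov's inequality.\<close>
  obtain N where N: "\<And>n. n \<ge> N \<Longrightarrow> measure \<nu> (bad (e / 2) n) < \<delta> / 2"
    using LIMSEQ_D[OF measure_bad_tendsto[of "e / 2"], of "\<delta> / 2"] e \<delta> by auto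
  define n where "n = max N 1"
  have n: "n > 0" "measure \<nu> (bad (e / 2) n) < \<delta> / 2" using N[of n] by (auto simp: n_def)
  \<comment> \<open>By \<open>norm_diff_T_le\<close> with error \<open>e / 2\<close>, off the bad
    set a distance above \<open>e\<close> forces a gap of at least \<open>c\<close>.\<close>
  define c where "c = e / 2 / (real DIM('a) * real n)"
  have c: "c > 0" using n e by (simp add: c_def)
  have V0: "0 \<le> V"
    using dual_obj_nonneg unfolding dual_value V_def by simp
  \<comment> \<open>The gap enters the cost with factor 2, so an excess below
    \<open>c * \<delta>\<close> leaves a mean gap of at most \<open>c * (\<delta> / 2)\<close>,
    which Markov's inequality at level \<open>c\<close> turns into
    \<open>\<delta> / 2\<close>.\<close>
  have "ennreal V < ennreal (V + c * \<delta>)"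
    using V0 c \<delta> by (intro ennreal_lessI) (auto intro: add_nonneg_pos)
  with T2 have "(INF \<pi>\<in>couplings \<xi> \<nu>. \<integral>\<^sup>+ p. ennreal (norm (fst p - snd p) ^ 2) \<partial>\<pi>) < ennreal (V + c * \<delta>)"
    unfolding T2_def by (rule le_less_trans)
  then obtain \<pi> where pi: "\<pi> \<in> couplings \<xi> \<nu>"
    and cost: "(\<integral>\<^sup>+ p. ennreal (norm (fst p - snd p) ^ 2) \<partial>\<pi>) < ennreal (V + c * \<delta>)"
    unfolding INF_less_iff by blast
  note [measurable] = coupling_measurable(2,3)[OF pi]
  note d = coupling_measurable(4,5)[OF pi]
  interpret \<pi>: prob_space \<pi> by (rule coupling_measurable(6)[OF pi])
  note gap = coupling_cost[OF pi xi2]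
  have "(\<integral>x. \<phi> x \<partial>\<xi>) - (\<integral>y. q y \<partial>\<nu>) + 2 * (\<integral>p. gap (fst p) (snd p) \<partial>\<pi>) < V + c * \<delta>"
    using cost unfolding gap(3) by (meson ennreal_leI not_le)
  then have gap_small: "(\<integral>p. gap (fst p) (snd p) \<partial>\<pi>) \<le> c * (\<delta> / 2)"
    using integral_phi_le[OF xi] unfolding V_def by simp
  have sm: "AE p in \<pi>. snd p \<in> smooth"
    using AE_smooth_nu unfolding d(2)[symmetric] by (rule AE_distrD[rotated]) measurable
  have gap0: "AE p in \<pi>. 0 \<le> gap (fst p) (snd p)"
    using sm by eventually_elim (use interior_subset gap_nonneg in \<open>auto simp: smooth_def\<close>)
  have [measurable]: "(\<lambda>p. gap (fst p) (snd p)) \<in> borel_measurable \<pi>"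
    using gap(1) by (rule borel_measurable_integrable)
  have "measure \<pi> {p \<in> space \<pi>. e < dist (fst p) (T (snd p))} \<le>
      measure \<pi> ({p \<in> space \<pi>. snd p \<in> bad (e / 2) n} \<union> {p \<in> space \<pi>. c \<le> gap (fst p) (snd p)})"
  proof (rule \<pi>.finite_measure_mono_AE)
    show "AE p in \<pi>. p \<in> {p \<in> space \<pi>. e < dist (fst p) (T (snd p))} \<longrightarrow>
        p \<in> {p \<in> space \<pi>. snd p \<in> bad (e / 2) n} \<union> {p \<in> space \<pi>. c \<le> gap (fst p) (snd p)}"
      using sm
    proof eventually_elim
      case (elim p)
      show ?case
      proof (cases "snd p \<in> bad (e / 2) n")
        case False
        have "c \<le> gap (fst p) (snd p)" if "e < dist (fst p) (T (snd p))"
        proof -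
          have "e / 2 \<le> real DIM('a) * real n * gap (fst p) (snd p)"
            using norm_diff_T_le[OF elim False n(1), of "fst p"] that by (simp add: dist_norm)
          then show ?thesis unfolding c_def using n(1) by (simp add: pos_divide_le_eq mult_ac)
        qed
        then show ?thesis by auto
      qed auto
    qed
  qed measurable
  also have "\<dots> \<le> measure \<pi> {p \<in> space \<pi>. snd p \<in> bad (e / 2) n} + measure \<pi> {p \<in> space \<pi>. c \<le> gap (fst p) (snd p)}"
    by (rule measure_Un_le) measurable
  also have "measure \<pi> {p \<in> space \<pi>. snd p \<in> bad (e / 2) n} = measure (distr \<pi> borel snd) (bad (e / 2) n)"
    by (subst measure_distr) (auto intro!: arg_cong[where f = "measure \<pi>"])
  also have "\<dots> = measure \<nu> (bad (e / 2) n)" by (simp only: d(2))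
  also have "measure \<pi> {p \<in> space \<pi>. c \<le> gap (fst p) (snd p)} \<le> (\<integral>p. gap (fst p) (snd p) \<partial>\<pi>) / c"
    using integral_Markov_inequality_measure[OF gap(1), of "space \<pi>" c] gap0 c by auto
  also have "\<dots> \<le> \<delta> / 2"
    using gap_small c by (simp add: pos_divide_le_eq mult.commute)
  finally have "measure \<pi> {p \<in> space \<pi>. e < dist (fst p) (T (snd p))} \<le> \<delta>"
    using n(2) by linarith
  with pi show ?thesis by (rule that)
qed

text \<open>On a near-optimal coupling \<open>fst p\<close> and \<open>T (snd p)\<close> have laws
  \<open>\<xi>\<close> and \<open>\<xi>0\<close> and are close in probability; comparing closed sets
  in both directions identifies the laws.\<close>

lemma T2_minimizer_unique:
  assumes xi: "\<xi> \<in> P2cx_above \<mu>" and T2: "T2 \<xi> \<nu> \<le> ennreal V"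
  shows "\<xi> = \<xi>0"
proof (rule measure_eq_if_closed_eq)
  have xi2: "\<xi> \<in> P2" using xi by (simp add: P2cx_above_def)
  show "prob_space \<xi>" "prob_space \<xi>0" "sets \<xi> = sets borel" "sets \<xi>0 = sets borel"
    using xi2 xi0_P2 by (auto simp: P2_def)
  fix F :: "'a set" assume F: "closed F"
  have close: "\<exists>(M :: ('a \<times> 'a) measure) X Y. prob_space M \<and> X \<in> borel_measurable M \<and> Y \<in> borel_measurable M \<and>
      distr M borel X = \<xi> \<and> distr M borel Y = \<xi>0 \<and> measure M {p \<in> space M. e < dist (X p) (Y p)} \<le> \<delta>"
    if e\<delta>: "0 < e" "0 < \<delta>" for e \<delta>
  proof -
    obtain \<pi> where pi: "\<pi> \<in> couplings \<xi> \<nu>" and le: "measure \<pi> {p \<in> space \<pi>. e < dist (fst p) (T (snd p))} \<le> \<delta>"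
      using near_optimal_concentrates[OF xi T2 e\<delta>] .
    note [measurable] = coupling_measurable(2,3)[OF pi]
    have "distr \<pi> borel (\<lambda>p. T (snd p)) = distr (distr \<pi> borel snd) borel T"
      by (subst distr_distr) (auto simp: comp_def)
    then have "distr \<pi> borel (\<lambda>p. T (snd p)) = \<xi>0"
      using coupling_measurable(5)[OF pi] by (simp add: \<xi>0_def)
    moreover have "(\<lambda>p. T (snd p)) \<in> borel_measurable \<pi>" by measurable
    ultimately show ?thesis using coupling_measurable[OF pi] le by blast
  qed
  have "measure \<xi> F \<le> measure \<xi>0 F"
    by (rule closed_measure_le_if_close[OF close F])
  moreover have "measure \<xi>0 F \<le> measure \<xi> F"
    by (rule closed_measure_le_if_close[OF _ F])
       (use close in \<open>subst dist_commute, blast\<close>)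
  ultimately show "measure \<xi> F = measure \<xi>0 F" by simp
qed

section \<open>Convexity properties of the Legendre transform\<close>

lemma convex_expansion_Psi: "convex_expansion Psi"
  unfolding convex_expansion_def
proof (intro conjI exI)
  \<comment> \<open>A probability measure concentrated on \<open>S\<close> rules out the empty set,
    which is where properness comes from.\<close>
  have "S \<noteq> {}"
  proof
    assume "S = {}"
    then have "AE y in \<nu>. False" using AE_S by simp
    then show False by simp
  qed
  then obtain y where y: "y \<in> S" by blast
  have "Psi y \<noteq> \<infinity>" using y by (simp add: Psi_eq_f)
  then have "proper_fun Psi" using Psi_not_MInf by (auto simp: proper_fun_def)
  moreover have "lsc Psi"
    unfolding Psi_eq by (intro lsc_SUP_continuous continuous_intros)
  moreover have "ereal_convex Psi"
    unfolding ereal_convex_def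
  proof (intro allI impI)
    fix x y and t :: real assume t: "0 < t \<and> t < 1"
    show "Psi (t *\<^sub>R x + (1 - t) *\<^sub>R y) \<le> ereal t * Psi x + ereal (1 - t) * Psi y"
    proof (cases "x \<in> S \<and> y \<in> S")
      case True
      then show ?thesis using convex_combination_le[of x y t] t by (simp add: Psi_eq_f)
    next
      case False
      then have top: "ereal t * Psi x + ereal (1 - t) * Psi y = \<infinity>"
        using t Psi_not_MInf[of x] Psi_not_MInf[of y] unfolding S_def
        by (cases "Psi x"; cases "Psi y") auto
      show ?thesis unfolding top by simp
    qed
  qed
  ultimately show "Psi \<in> A_cx" by (simp add: A_cx_def)
  \<comment> \<open>The difference equals \<open>\<phi> x / 2\<close>, so the upper Hessian bound on
    \<open>phi0\<close> amounts to convexity of \<open>\<phi>\<close>.\<close>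
  show "convex_on UNIV (\<lambda>x. norm x ^ 2 / 2 - (norm x ^ 2 / 2 - \<phi> x / 2))"
    using convex_on_cmul[OF _ convex_phi, of "1 / 2"] by simp
  show "Psi = legendre (\<lambda>x. ereal (norm x ^ 2 / 2 - \<phi> x / 2))" by (fact Psi_def)
qed

text \<open>Substituting \<open>x = y + z\<close> in the supremum shows that \<open>q\<close> is a supremum of the convex
  functions \<open>\<lambda>y. \<phi> (y + z) - norm z ^ 2\<close>, i.e. \<open>f\<close> minus half the squared norm is convex.\<close>

lemma strongly_convex:
  assumes "x \<in> S" "y \<in> S" "0 < t" "t < 1"
  shows "f (t *\<^sub>R x + (1 - t) *\<^sub>R y) + t * (1 - t) * (norm (x - y) ^ 2 / 2) \<le> t * f x + (1 - t) * f y"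
proof -
  define m where "m = t *\<^sub>R x + (1 - t) *\<^sub>R y"
  have m: "m \<in> S"
    using convex_S assms by (auto simp: m_def convex_def)
  have "ereal (q m) \<le> ereal (t * q x + (1 - t) * q y)"
    unfolding Qbar2_phi_S[OF m, symmetric]
  proof (rule Qbar2_le)
    fix w
    \<comment> \<open>The offset of \<open>w\<close> from \<open>m\<close> is carried unchanged to
      both endpoints, so all three penalties equal \<open>norm z ^ 2\<close>.\<close>
    define z where "z = w - m"
    have "w = t *\<^sub>R (x + z) + (1 - t) *\<^sub>R (y + z)" by (simp add: z_def m_def algebra_simps)
    then have "\<phi> w \<le> t * \<phi> (x + z) + (1 - t) * \<phi> (y + z)"
      using convex_phi assms unfolding convex_on_def by auto
    moreover have "t * (\<phi> (x + z) - norm z ^ 2) \<le> t * q x" "(1 - t) * (\<phi> (y + z) - norm z ^ 2) \<le> (1 - t) * q y"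
      using Qbar2_ge[of \<phi> "x + z" x] Qbar2_ge[of \<phi> "y + z" y] assms
      by (auto intro!: mult_left_mono simp: Qbar2_phi_S)
    ultimately show "\<phi> w - norm (w - m) ^ 2 \<le> t * q x + (1 - t) * q y"
      unfolding z_def[symmetric] by (simp add: algebra_simps)
  qed
  then have "q m \<le> t * q x + (1 - t) * q y" by simp
  \<comment> \<open>The exact convexity defect of the squared norm; on passing from \<open>q\<close>
    back to \<open>f\<close> it supplies the modulus.\<close>
  moreover have "norm m ^ 2 + t * (1 - t) * norm (x - y) ^ 2 = t * norm x ^ 2 + (1 - t) * norm y ^ 2"
    unfolding m_def power2_norm_eq_inner
    by (simp add: inner_add_left inner_add_right inner_diff_left inner_diff_right inner_commute algebra_simps)
  ultimately show ?thesis unfolding q_def m_def[symmetric] by (simp add: algebra_simps diff_divide_distrib)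
qed

lemma uniformly_convex_Psi: "uniformly_convex Psi"
  unfolding uniformly_convex_def
proof (intro exI conjI allI impI)
  let ?w = "\<lambda>s. ereal (s ^ 2 / 2)"
  show "mono_on {0..} ?w" by (auto intro!: mono_onI power_mono)
  show "0 \<le> ?w s" "(?w s = 0) = (s = 0)" for s by auto
  fix x y :: 'a and t :: real assume a: "Psi x < \<infinity> \<and> Psi y < \<infinity> \<and> 0 < t \<and> t < 1"
  then have S: "x \<in> S" "y \<in> S" by (auto simp: S_def)
  have "t *\<^sub>R x + (1 - t) *\<^sub>R y \<in> S" using convex_S S a by (auto simp: convex_def)
  then show "Psi (t *\<^sub>R x + (1 - t) *\<^sub>R y) + ereal (t * (1 - t)) * ?w (norm (x - y)) \<le> ereal t * Psi x + ereal (1 - t) * Psi y"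
    using strongly_convex[OF S] a S by (simp add: Psi_eq_f)
qed

end

section \<open>Expansion property, uniform convexity and the unique minimizer\<close>

theorem mainTheorem10:
  fixes \<mu> \<nu> :: "'a::euclidean_space measure" and \<phi> :: "'a \<Rightarrow> real"
  assumes mu: "\<mu> \<in> P2"
    and nu: "\<nu> \<in> P2"
    and nu_ac: "absolutely_continuous lborel \<nu>"
    and phi_A: "(\<lambda>x. ereal (\<phi> x)) \<in> A_cx"
    and phi_C: "\<phi> \<in> C_b2"
    and phi_opt: "dual_obj \<mu> \<nu> \<phi> = D2 \<mu> \<nu>"
  defines "phi0 \<equiv> (\<lambda>x. norm x ^ 2 / 2 - \<phi> x / 2)"
  shows "convex_expansion (legendre (\<lambda>x. ereal (phi0 x)))
       \<and> uniformly_convex (legendre (\<lambda>x. ereal (phi0 x)))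
       \<and> (AE y in \<nu>. \<exists>v. diff_at (legendre (\<lambda>x. ereal (phi0 x))) y v)
       \<and> grad (legendre (\<lambda>x. ereal (phi0 x))) \<in> borel_measurable borel
       \<and> (let \<xi>0 = distr \<nu> borel (grad (legendre (\<lambda>x. ereal (phi0 x)))) in
            \<xi>0 \<in> P2cx_above \<mu> \<and>
            (\<forall>\<xi>\<in>P2cx_above \<mu>. T2 \<xi>0 \<nu> \<le> T2 \<xi> \<nu>) \<and>
            (\<forall>\<xi>\<in>P2cx_above \<mu>. T2 \<xi> \<nu> \<le> T2 \<xi>0 \<nu> \<longrightarrow> \<xi> = \<xi>0))"
proof -
  obtain C where "\<And>x. \<bar>\<phi> x\<bar> \<le> C * (1 + norm x ^ 2)"
    using phi_C by (auto simp: C_b2_def)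
  then interpret dual_optimizer \<mu> \<nu> \<phi> C
    using assms by unfold_locales (auto simp: A_cx_real_iff)
  have Psi: "legendre (\<lambda>x. ereal (phi0 x)) = Psi"
    by (simp add: Psi_def phi0_def)
  \<comment> \<open>As \<open>grad\<close> defaults to 0 where no derivative exists, this is what
    makes the pushforward one by a genuine gradient.\<close>
  have "AE y in \<nu>. \<exists>v. diff_at Psi y v"
    using AE_smooth_nu by eventually_elim (use smooth_grad in \<open>auto simp: diff_at_iff\<close>)
  \<comment> \<open>The dual value \<open>V\<close> bounds the cost of \<open>\<xi>0\<close> from
    above and every feasible cost from below.\<close>
  moreover have "\<forall>\<xi>\<in>P2cx_above \<mu>. T2 \<xi>0 \<nu> \<le> T2 \<xi> \<nu>"
    using order_trans[OF T2_xi0 T2_ge] by blast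
  moreover have "\<forall>\<xi>\<in>P2cx_above \<mu>. T2 \<xi> \<nu> \<le> T2 \<xi>0 \<nu> \<longrightarrow> \<xi> = \<xi>0"
    using T2_minimizer_unique order_trans[OF _ T2_xi0] by blast
  ultimately show ?thesis
    unfolding Psi Let_def \<xi>0_def[symmetric]
    using convex_expansion_Psi uniformly_convex_Psi grad_borel xi0_above by blast
qed

end
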